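(* Let $\{z_j\}\subseteq\mathcal{R}$ be a sequence with $1\le|z_j|\to+\infty$. The following properties hold. (i) If $\{z_j\}$ has exponent of convergence $1$ and upper density $d^+<\frac12$, then $\{z_j\}$ is a zero-set for $\mathcal{M}^2_\omega(\mathcal{R})\cap\operatorname{Hol}(\overline{\mathcal{R}})$. (ii) If $\{z_j\}$ is a zero-set for $\mathcal{M}^2_\omega(\mathcal{R})\cap\operatorname{Hol}(\overline{\mathcal{R}})$, then $$\limsup_{R\to+\infty}\frac1{\log R}\sum_{|z_j|\le R}\Re\big(1/z_j\big)\le\frac2\pi .$$
   Context: $\mathcal{R}=\{z\in\mathbf{C}:\Re z>0\}$, $\overline{\mathcal{R}}$ its closure, and $\operatorname{Hol}(\overline{\mathcal{R}})$ denotes the functions holomorphic on (a neighborhood of) $\overline{\mathcal{R}}$. For $0<b<\infty$, $S_b=\{x+iy:0<x<b\}$ and $H^2(S_b)$ is the space of holomorphic $f$ on $S_b$ with $\sup_{0<x<b}\int_{-\infty}^{+\infty}|f(x+iy)|^2\,dy<\infty$; such functions have $L^2$ boundary values on the imaginary axis. Let $\omega=\sum_{n=0}^{+\infty}\frac{2^n}{n!}\,\delta_{n/2}(x)\otimes dy$ on $\overline{\mathcal{R}}$. $\mathcal{M}^2_\omega(\mathcal{R})$ is the space of holomorphic functions $f$ on $\mathcal{R}$ such that $f\in H^2(S_b)$ for every $0<b<\infty$ and $f\in L^2(\overline{\mathcal{R}},d\omega)$, i.e. $\sum_{n\ge0}\frac{2^n}{n!}\int_{-\infty}^{+\infty}|f(\frac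 n2+iy)|^2\,dy<\infty$ (boundary values used for $n=0$). For a sequence $\{z_j\}$ with $|z_j|\to+\infty$, its exponent of convergence is $\rho_1=\inf\{\rho>0:\sum_j1/|z_j|^\rho<\infty\}$, its counting function is $n(r)=\#\{z_j:|z_j|\le r\}$, and its upper density is $d^+=\limsup_{r\to+\infty}n(r)/r^{\rho_1}$. A sequence $\{z_j\}$ is a zero-set for a space of functions in $\operatorname{Hol}(\overline{\mathcal{R}})$ if there is a function in the space, not identically zero, whose zeros in $\overline{\mathcal{R}}$, counted with multiplicity, are exactly the $z_j$. *)

theory Defs
  imports "HOL-Complex_Analysis.Complex_Analysis"
begin

definition right_half_plane :: "complex set" where
  "right_half_plane = {z. Re z > 0}"

definition strip :: "real \<Rightarrow> complex set" where
  "strip b = {z. 0 < Re z \<and> Re z < b}"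

text \<open>
  Function spaces over a domain are represented as sets of total functions; membership depends
  only on the values on the domain in question.
\<close>

definition H2_strip :: "real \<Rightarrow> (complex \<Rightarrow> complex) set" where
  "H2_strip b = {f. f holomorphic_on strip b \<and>
     (SUP x\<in>{0<..<b}. \<integral>\<^sup>+ y. ennreal ((norm (f (Complex x y)))\<^sup>2) \<partial>lborel) < \<infinity>}"

definition L2_boundary_value :: "(complex \<Rightarrow> complex) \<Rightarrow> (real \<Rightarrow> complex) \<Rightarrow> bool" where
  "L2_boundary_value f g \<longleftrightarrow>
     g \<in> borel_measurable borel \<and>
     (\<integral>\<^sup>+ y. ennreal ((norm (g y))\<^sup>2) \<partial>lborel) < \<infinity> \<and>
     ((\<lambda>x. \<integral>\<^sup>+ y. ennreal ((norm (f (Complex x y) - g y))\<^sup>2) \<partial>lborel) \<longlongrightarrow> 0) (at_right 0)"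

text \<open>
  The measure $\sum_n \frac{2^n}{n!}\,\delta_{n/2}(x)\otimes dy$, realised as the image of the
  weighted counting measure on the naturals times Lebesgue measure under
  $(n,y)\mapsto n/2+iy$; see \<open>nn_integral_omega\<close> below.
\<close>

definition omega :: "complex measure" where
  "omega = distr (density (count_space UNIV) (\<lambda>n. ennreal (2 ^ n / fact n)) \<Otimes>\<^sub>M lborel) borel
     (\<lambda>(n::nat, y). Complex (real n / 2) y)"

definition extend_to_boundary :: "(complex \<Rightarrow> complex) \<Rightarrow> (real \<Rightarrow> complex) \<Rightarrow> complex \<Rightarrow> complex" where
  "extend_to_boundary f g w = (if Re w > 0 then f w else if Re w = 0 then g (Im w) else 0)"

definition M2_omega :: "(complex \<Rightarrow> complex) set" where
  "M2_omega = {f. f holomorphic_on right_half_plane \<and> (\<forall>b>0. f \<in> H2_strip b) \<and>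
     (\<exists>g. L2_boundary_value f g \<and>
        (\<integral>\<^sup>+ w. ennreal ((norm (extend_to_boundary f g w))\<^sup>2) \<partial>omega) < \<infinity>)}"

text \<open>\<open>analytic_on\<close> means holomorphic on an open neighbourhood of the set.\<close>

definition Hol_closed_half_plane :: "(complex \<Rightarrow> complex) set" where
  "Hol_closed_half_plane = {f. f analytic_on closure right_half_plane}"

definition is_zero_set :: "(complex \<Rightarrow> complex) set \<Rightarrow> (nat \<Rightarrow> complex) \<Rightarrow> bool" where
  "is_zero_set X z \<longleftrightarrow> (\<exists>f\<in>X.
     (\<exists>w\<in>closure right_half_plane. f w \<noteq> 0) \<and>
     {w \<in> closure right_half_plane. f w = 0} = range z \<and>
     (\<forall>w\<in>range z. finite {j. z j = w} \<and> zorder f w = int (card {j. z j = w})))"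

text \<open>Taken in the extended reals, so that the infimum of the empty set is $\infty$.\<close>

definition exponent_of_convergence :: "(nat \<Rightarrow> complex) \<Rightarrow> ereal" where
  "exponent_of_convergence z =
     Inf {ereal \<rho> | \<rho>. \<rho> > 0 \<and> summable (\<lambda>j. 1 / norm (z j) powr \<rho>)}"

definition counting :: "(nat \<Rightarrow> complex) \<Rightarrow> real \<Rightarrow> nat" where
  "counting z r = card {j. norm (z j) \<le> r}"

text \<open>Meaningful only when the exponent of convergence is finite.\<close>

definition upper_density :: "(nat \<Rightarrow> complex) \<Rightarrow> ereal" where
  "upper_density z = Limsup at_top
     (\<lambda>r. ereal (real (counting z r) / r powr real_of_ereal (exponent_of_convergence z)))"

lemma nn_integral_omega:
  assumes [measurable]: "h \<in> borel_measurable borel"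
  shows "(\<integral>\<^sup>+ w. h w \<partial>omega) =
    (\<Sum>n. ennreal (2 ^ n / fact n) * (\<integral>\<^sup>+ y. h (Complex (real n / 2) y) \<partial>lborel))"
proof -
  let ?M = "density (count_space (UNIV :: nat set)) (\<lambda>n. ennreal (2 ^ n / fact n))"
  have C: "(\<lambda>(n::nat, y). Complex (real n / 2) y) \<in> borel_measurable (?M \<Otimes>\<^sub>M lborel)"
  proof -
    have [measurable]: "(\<lambda>n::nat. real n / 2) \<in> borel_measurable ?M"
      by simp
    show ?thesis
      unfolding Complex_eq by measurable
  qed
  have "(\<integral>\<^sup>+ w. h w \<partial>omega) = (\<integral>\<^sup>+ p. h (case p of (n, y) \<Rightarrow> Complex (real n / 2) y) \<partial>(?M \<Otimes>\<^sub>M lborel))"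
    unfolding omega_def by (rule nn_integral_distr[OF C]) simp
  also have "\<dots> = (\<integral>\<^sup>+ n. \<integral>\<^sup>+ y. h (Complex (real n / 2) y) \<partial>lborel \<partial>?M)"
    by (subst lborel.nn_integral_fst[symmetric]) (use measurable_compose[OF C assms] in simp_all)
  also have "\<dots> = (\<integral>\<^sup>+ n. ennreal (2 ^ n / fact n) *
      (\<integral>\<^sup>+ y. h (Complex (real n / 2) y) \<partial>lborel) \<partial>count_space UNIV)"
    by (rule nn_integral_density) simp_all
  finally show ?thesis
    by (simp add: nn_integral_count_space_nat)
qed

end

theory Submission
  imports Defs
begin

text \<open>
  Necessity.  Let \<open>f\<close> be in the space and holomorphic on the closed half-plane.  Cauchy's formula on a
  vertical strip bounds \<open>|f|\<^sup>2\<close> pointwise by its integrals over the two boundary lines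
  (\<open>square_bound_in_strip\<close>).  On the lines \<open>Re w = n/2\<close> those integrals are
  \<open>O(n!/2\<^sup>n)\<close>, so that \<open>|f w|\<^sup>2\<close> is at most \<open>C/x * exp (C * x) * R powr (2 * x)\<close> with
  \<open>x = Re w\<close> whenever \<open>0 < x \<le> R\<close> and \<open>R \<ge> 1\<close> (\<open>M2_omega_growth\<close>); on the imaginary axis \<open>f\<close> is square
  integrable.  These two facts feed an argument in the style of Carleman on the half-disc
  \<open>Re w > 0, |w| < R\<close>.  Divide \<open>f\<close> by the half-disc's Blaschke factors of its zeros in
  \<open>|w| \<le> R/4\<close>; these have modulus one on the whole boundary.  Square the quotient, multiply it by
  \<open>(w\<^sup>2 + R\<^sup>2)/R\<^sup>2\<close>, which vanishes at the corners \<open>\<plusminus>iR\<close> just fast enough to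
  cancel the factor \<open>C/x\<close>, and by \<open>exp (-(2 ln R + C) w)\<close>, which is unimodular on the axis and absorbs
  the growth on the arc.  The resulting function has a boundary integral that stays bounded, and Cauchy's formula
  at the point \<open>1/4\<close> shows that the product of \<open>|b(1/4)|\<^sup>-\<^sup>2\<close> over the Blaschke factors
  \<open>b\<close> is \<open>O(R powr (1/2))\<close> (\<open>half_disc_zero_bound\<close>).  The factor of a zero \<open>a\<close>
  contributes at least \<open>exp (239/272 * Re (1/a))\<close> (\<open>norm_reflected_factor_ge\<close>).  Taking
  logarithms, the sum of \<open>Re (1/a)\<close> is at most \<open>136/239 * ln R + O(1)\<close>, and
  \<open>136/239 < 4/7 < 2/\<pi>\<close>.

  Sufficiency.  The product \<open>P w\<close> of all \<open>1 - w\<^sup>2/z\<^sub>j\<^sup>2\<close> has the prescribed zeros in the closed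
  half-plane, the others being their negatives.  Pairing each zero with its negative makes the growth of
  \<open>P\<close> depend on the counting function alone: if at most \<open>N + d s\<close> of the points have modulus
  \<open>\<le> s\<close>, then \<open>P\<close> has exponential type at most \<open>\<pi> d\<close>
  (\<open>sum_ln_le_of_counting_bound\<close>, \<open>even_canonical_product_exists\<close>).  For \<open>d < 1/2\<close> this is less than
  the rate \<open>\<pi>/2\<close> at which \<open>exp (w Ln (w + 1))\<close> decays along vertical lines
  (\<open>Re_mult_Ln_plus_one_le\<close>), an elementary substitute for the Gamma function.  The modulus of that function on
  \<open>Re w = x\<close> is otherwise about \<open>(x + 1)\<^sup>x\<close>, and at \<open>x = n/2\<close> the weight
  \<open>2\<^sup>n/n!\<close> reduces its square to \<open>(n + 2)\<^sup>n/n! \<le> exp (n + 2)\<close>.  An exponential factor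
  \<open>exp (-a w)\<close> makes up for the remaining geometric growth, so
  \<open>P w * exp (w Ln (w + 1) - a w)\<close> is in the space (\<open>M2_omega_if_bounded\<close>).
\<close>

section \<open>Pointwise bounds from square means on a strip\<close>

lemma borel_measurable_Complex [measurable]:
  "Complex x \<in> borel_measurable borel" "(\<lambda>x. Complex x y) \<in> borel_measurable borel"
  unfolding Complex_eq by measurable

lemma norm_integral_le_nn_integral:
  fixes g :: "real \<Rightarrow> complex"
  assumes "continuous_on {s..t} g" "0 \<le> C"
    and "(\<integral>\<^sup>+y. ennreal (norm (g y)) * indicator {s..t} y \<partial>lborel) \<le> ennreal C"
  shows "norm (integral {s..t} g) \<le> C"
proof -
  have c: "continuous_on {s..t} (\<lambda>y. norm (g y))"
    using assms(1) by (intro continuous_intros)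
  have "norm (integral {s..t} g) \<le> integral {s..t} (\<lambda>y. norm (g y))"
    by (intro integral_norm_bound_integral integrable_continuous_real assms c order_refl)
  moreover have "ennreal (integral {s..t} (\<lambda>y. norm (g y))) \<le> ennreal C"
    using nn_integral_has_integral_lebesgue'[of "{s..t}" "\<lambda>y. norm (g y)",
        OF _ integrable_integral[OF integrable_continuous_real[OF c]]] assms(3) by simp
  ultimately show ?thesis
    using assms(2) by (simp add: ennreal_le_iff)
qed

text \<open>
  Integrals over straight segments are estimated by Lebesgue integrals over the real line, because that is the
  form in which square means over vertical lines are given.
\<close>
lemma norm_contour_integral_vertical_le:
  assumes "continuous_on (closed_segment (Complex c s) (Complex c t)) h" "s < t" "0 \<le> C"
    and "(\<integral>\<^sup>+y. ennreal (norm (h (Complex c y))) * indicator {s..t} y \<partial>lborel) \<le> ennreal C"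
  shows "norm (contour_integral (linepath (Complex c s) (Complex c t)) h) \<le> C"
proof -
  have "contour_integral (linepath (Complex c s) (Complex c t)) h
          = \<i> * integral {s..t} (\<lambda>y. h (Complex c y))"
    using assms(2) by (intro contour_integral_linepath_same_Re) auto
  moreover have "norm (integral {s..t} (\<lambda>y. h (Complex c y))) \<le> C"
  proof (rule norm_integral_le_nn_integral[OF _ assms(3,4)])
    show "continuous_on {s..t} (\<lambda>y. h (Complex c y))"
      by (rule continuous_on_compose2[OF assms(1)])
         (use assms(2) in \<open>auto simp: Complex_eq closed_segment_same_Re
            closed_segment_eq_real_ivl intro!: continuous_intros\<close>)
  qed
  ultimately show ?thesis by (simp add: norm_mult)
qed

lemma norm_contour_integral_horizontal_le:
  assumes "continuous_on (closed_segment (Complex s c) (Complex t c)) h" "s < t" "0 \<le> C"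
    and "(\<integral>\<^sup>+x. ennreal (norm (h (Complex x c))) * indicator {s..t} x \<partial>lborel) \<le> ennreal C"
  shows "norm (contour_integral (linepath (Complex s c) (Complex t c)) h) \<le> C"
proof -
  have c: "continuous_on {s..t} (\<lambda>x. h (Complex x c))"
    by (rule continuous_on_compose2[OF assms(1)])
       (use assms(2) in \<open>auto simp: Complex_eq closed_segment_same_Im
            closed_segment_eq_real_ivl intro!: continuous_intros\<close>)
  have "contour_integral (linepath (Complex s c) (Complex t c)) h
          = integral {s..t} (\<lambda>x. h (Complex x c))"
  proof (intro contour_integral_unique)
    have "((\<lambda>z. h (Complex 0 c + z)) has_contour_integral integral {s..t} (\<lambda>x. h (Complex x c)))
       (linepath (of_real s) (of_real t))"
    proof (subst has_contour_integral_linepath_Reals_iff)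
      have "Complex 0 c + of_real x = Complex x c" for x by (simp add: complex_eq_iff)
      then show "((\<lambda>x. h (Complex 0 c + complex_of_real x)) has_integral
             integral {s..t} (\<lambda>x. h (Complex x c))) {Re (of_real s)..Re (of_real t)}"
        using integrable_integral[OF integrable_continuous_real[OF c]] by simp
    qed (use assms(2) in auto)
    then show "(h has_contour_integral integral {s..t} (\<lambda>x. h (Complex x c)))
       (linepath (Complex s c) (Complex t c))"
    proof (unfold has_contour_integral_linepath, elim has_integral_eq[rotated])
      fix x :: real
      have "Complex 0 c + linepath (of_real s) (of_real t) x = linepath (Complex s c) (Complex t c) x"
        "of_real t - of_real s = Complex t c - Complex s c"
        by (simp_all add: linepath_def complex_eq_iff algebra_simps)
      then show "h (Complex 0 c + linepath (of_real s) (of_real t) x) * (of_real t - of_real s)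
           = h (linepath (Complex s c) (Complex t c) x) * (Complex t c - Complex s c)"
        by simp
    qed
  qed
  then show ?thesis using norm_integral_le_nn_integral[OF c assms(3,4)] by simp
qed

lemma norm_contour_integral_linepath_commute:
  assumes "continuous_on (closed_segment a b) h"
  shows "norm (contour_integral (linepath b a) h) = norm (contour_integral (linepath a b) h)"
  using contour_integral_reverse_linepath[OF assms] by (metis norm_minus_cancel)

text \<open>
  The horizontal sides of a tall rectangle may be placed where \<open>F\<close> has small mean: by Tonelli, \<open>F\<close> has
  finite integral over the strip, so the horizontal means cannot exceed 1 for every large height.  This replaces
  any decay of \<open>F\<close> at infinity.
\<close>
lemma far_horizontal_segments_small:
  fixes F :: "complex \<Rightarrow> real"
  assumes [measurable]: "F \<in> borel_measurable borel"
    and M: "\<And>x. a \<le> x \<Longrightarrow> x \<le> b \<Longrightarrow> (\<integral>\<^sup>+y. ennreal (F (Complex x y)) \<partial>lborel) \<le> ennreal M"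
  shows "\<exists>T>T0. (\<integral>\<^sup>+x. ennreal (F (Complex x T)) * indicator {a..b} x \<partial>lborel) \<le> 1
              \<and> (\<integral>\<^sup>+x. ennreal (F (Complex x (- T))) * indicator {a..b} x \<partial>lborel) \<le> 1"
proof (rule ccontr)
  assume neg: "\<not> ?thesis"
  have [measurable]: "(\<lambda>p. Complex (fst p) (snd p)) \<in> borel_measurable (lborel \<Otimes>\<^sub>M lborel)"
    unfolding Complex_eq by measurable
  have [measurable]: "(\<lambda>p. Complex (fst p) (- snd p)) \<in> borel_measurable (lborel \<Otimes>\<^sub>M lborel)"
    unfolding Complex_eq by measurable
  \<comment> \<open>The means at the heights \<open>T\<close> and \<open>- T\<close> are treated together, since both sides of one rectangle must be small.\<close>
  let ?G = "\<lambda>x T. (ennreal (F (Complex x T)) + ennreal (F (Complex x (- T)))) * indicator {a..b} x"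
  have meas: "case_prod ?G \<in> borel_measurable (lborel \<Otimes>\<^sub>M lborel)"
    by (simp add: case_prod_beta')
  define D where "D = 2 * max 0 M * max 0 (b - a)"
  have "D \<ge> 0" by (simp add: D_def)
  then have "ennreal (D + 1) = (\<integral>\<^sup>+T. indicator {T0<..T0 + (D + 1)} T \<partial>lborel)"
    by simp
  also have "\<dots> \<le> (\<integral>\<^sup>+T. \<integral>\<^sup>+x. ?G x T \<partial>lborel \<partial>lborel)"
  proof (rule nn_integral_mono)
    fix T :: real
    show "indicator {T0<..T0 + (D + 1)} T \<le> (\<integral>\<^sup>+x. ?G x T \<partial>lborel)"
    proof (cases "T > T0")
      case True
      have "(\<integral>\<^sup>+x. ?G x T \<partial>lborel) = (\<integral>\<^sup>+x. ennreal (F (Complex x T)) * indicator {a..b} x \<partial>lborel)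
              + (\<integral>\<^sup>+x. ennreal (F (Complex x (- T))) * indicator {a..b} x \<partial>lborel)"
        by (simp add: distrib_right nn_integral_add)
      moreover have "1 < (\<integral>\<^sup>+x. ennreal (F (Complex x T)) * indicator {a..b} x \<partial>lborel) \<or>
              1 < (\<integral>\<^sup>+x. ennreal (F (Complex x (- T))) * indicator {a..b} x \<partial>lborel)"
        using neg True by (auto simp: not_le)
      ultimately have "1 \<le> (\<integral>\<^sup>+x. ?G x T \<partial>lborel)"
        by (auto intro: add_increasing add_increasing2 less_imp_le)
      then show ?thesis by (simp add: indicator_def)
    qed simp
  qed
  also have "\<dots> = (\<integral>\<^sup>+x. \<integral>\<^sup>+T. ?G x T \<partial>lborel \<partial>lborel)"
    by (rule lborel_pair.Fubini') (use meas in simp)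
  also have "\<dots> \<le> (\<integral>\<^sup>+x. ennreal (2 * max 0 M) * indicator {a..b} x \<partial>lborel)"
  proof (rule nn_integral_mono)
    fix x :: real
    show "(\<integral>\<^sup>+T. ?G x T \<partial>lborel) \<le> ennreal (2 * max 0 M) * indicator {a..b} x"
    proof (cases "x \<in> {a..b}")
      case True
      have "(\<integral>\<^sup>+T. ennreal (F (Complex x (- T))) \<partial>lborel) = (\<integral>\<^sup>+T. ennreal (F (Complex x T)) \<partial>lborel)"
        using nn_integral_real_affine[of "\<lambda>T. ennreal (F (Complex x T))" "-1" 0] by simp
      then have "(\<integral>\<^sup>+T. ?G x T \<partial>lborel) = 2 * (\<integral>\<^sup>+T. ennreal (F (Complex x T)) \<partial>lborel)"
        using True by (simp add: nn_integral_add mult_2)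
      also have "\<dots> \<le> 2 * ennreal (max 0 M)"
        using M[of x] True by (intro mult_left_mono) (auto simp: max_def ennreal_neg split: if_splits)
      finally show ?thesis using True by (simp add: ennreal_mult)
    qed simp
  qed
  also have "\<dots> = ennreal D"
    by (cases "a \<le> b") (auto simp: nn_integral_cmult D_def ennreal_mult)
  finally show False using \<open>D \<ge> 0\<close> by simp
qed

text \<open>
  Cauchy's formula for \<open>f\<^sup>2\<close> on a rectangle of half-height \<open>T\<close>.  On the vertical sides the kernel
  \<open>1/(w - z)\<close> is bounded by the reciprocal of the distance to the line, so squaring \<open>f\<close> leaves exactly
  the given square means; the horizontal sides contribute \<open>O(1/T)\<close>.  The uniform bound \<open>M\<close> on all lines
  places the horizontal sides, while the estimate depends on the two outer lines alone.  For \<open>M2_omega\<close> this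
  matters: quantitative information is available there only on the lines \<open>Re w = n/2\<close>.
\<close>
lemma square_bound_in_strip:
  assumes cont: "continuous_on {w. a \<le> Re w \<and> Re w \<le> b} f"
    and hol: "f holomorphic_on {w. a < Re w \<and> Re w < b}"
    and M: "\<And>x. a \<le> x \<Longrightarrow> x \<le> b \<Longrightarrow> (\<integral>\<^sup>+y. ennreal ((norm (f (Complex x y)))\<^sup>2) \<partial>lborel) \<le> ennreal M"
    and A: "(\<integral>\<^sup>+y. ennreal ((norm (f (Complex a y)))\<^sup>2) \<partial>lborel) \<le> ennreal A" "0 \<le> A"
    and B: "(\<integral>\<^sup>+y. ennreal ((norm (f (Complex b y)))\<^sup>2) \<partial>lborel) \<le> ennreal B" "0 \<le> B"
    and z: "a < Re z" "Re z < b"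
  shows "(norm (f z))\<^sup>2 \<le> (A / (Re z - a) + B / (b - Re z)) / (2 * pi)"
proof -
  let ?S = "{w. a \<le> Re w \<and> Re w \<le> b}"
  define F where "F = (\<lambda>w. norm (indicator ?S w *\<^sub>R (f w)\<^sup>2))"
  have S: "closed ?S" "convex ?S"
  proof -
    have "?S = {w. a \<le> Re w} \<inter> {w. Re w \<le> b}" by auto
    then show "closed ?S" "convex ?S"
      by (simp_all only: closed_Int closed_halfspace_Re_ge closed_halfspace_Re_le
            convex_Int convex_halfspace_Re_ge convex_halfspace_Re_le)
  qed
  have Fm [measurable]: "F \<in> borel_measurable borel"
    unfolding F_def
    by (rule measurable_compose[OF borel_measurable_continuous_on_indicator borel_measurable_continuous_onI[OF continuous_on_norm_id]])
       (use S cont in \<open>auto intro!: continuous_intros\<close>)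
  have Feq: "F w = (norm (f w))\<^sup>2" if "w \<in> ?S" for w
    using that by (simp add: F_def norm_power)
  let ?C = "A / (Re z - a) + B / (b - Re z)"
  \<comment> \<open>\<open>T\<close> is chosen such that the two horizontal sides contribute at most \<open>\<epsilon>\<close> together.\<close>
  have key: "2 * pi * (norm (f z))\<^sup>2 \<le> ?C + \<epsilon>" if "\<epsilon> > 0" for \<epsilon> :: real
  proof -
    obtain T where T: "T > \<bar>Im z\<bar> + 2 / \<epsilon>"
      and T1: "(\<integral>\<^sup>+x. ennreal (F (Complex x T)) * indicator {a..b} x \<partial>lborel) \<le> 1"
      and T2: "(\<integral>\<^sup>+x. ennreal (F (Complex x (- T))) * indicator {a..b} x \<partial>lborel) \<le> 1"
      using far_horizontal_segments_small[OF Fm, of a b M "\<bar>Im z\<bar> + 2 / \<epsilon>"] M Feq by auto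
    have T': "T > \<bar>Im z\<bar>" "2 / (T - \<bar>Im z\<bar>) \<le> \<epsilon>" "T > 0"
    proof -
      have "2 / \<epsilon> > 0" using that by simp
      then show "T > \<bar>Im z\<bar>" "T > 0" using T by linarith+
      then show "2 / (T - \<bar>Im z\<bar>) \<le> \<epsilon>" using T that by (simp add: field_simps)
    qed
    define p1 p2 p3 p4 where "p1 = Complex a (- T)" and "p2 = Complex b (- T)"
      and "p3 = Complex b T" and "p4 = Complex a T"
    note p_defs = p1_def p2_def p3_def p4_def
    let ?h = "\<lambda>w. (f w)\<^sup>2 / (w - z)"
    have zb: "z \<in> box p1 p3"
      using z T' by (auto simp: in_box_complex_iff p_defs)
    have "((\<lambda>w. (f w)\<^sup>2 / (w - z)) has_contour_integral
            (2 * pi * \<i> * winding_number (rectpath p1 p3) z * (f z)\<^sup>2)) (rectpath p1 p3)"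
    proof (rule Cauchy_integral_formula_weak[where k = "{}", OF S(2)])
      have int: "interior ?S \<subseteq> {w. a < Re w \<and> Re w < b}"
      proof
        fix x assume "x \<in> interior ?S"
        then obtain e where e: "e > 0" "cball x e \<subseteq> ?S" by (auto simp: mem_interior_cball)
        have "x - of_real e \<in> cball x e" "x + of_real e \<in> cball x e"
          using e by (auto simp: dist_norm)
        then show "x \<in> {w. a < Re w \<and> Re w < b}" using e by fastforce
      qed
      have op: "open {w. a < Re w \<and> Re w < b}"
        by (intro open_Collect_conj open_Collect_less continuous_intros)
      show "continuous_on ?S (\<lambda>w. (f w)\<^sup>2)" by (intro continuous_intros cont)
      have hol2: "(\<lambda>w. (f w)\<^sup>2) holomorphic_on {w. a < Re w \<and> Re w < b}"
        by (intro holomorphic_intros hol)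
      show "(\<lambda>w. (f w)\<^sup>2) field_differentiable at x" if "x \<in> interior ?S - {}" for x
        using that int hol2 op holomorphic_on_imp_differentiable_at by blast
      show "z \<in> interior ?S - {}"
      proof -
        have "{w. a < Re w \<and> Re w < b} \<subseteq> interior ?S"
          by (rule interior_maximal) (use op in auto)
        then show ?thesis using z by auto
      qed
      show "path_image (rectpath p1 p3) \<subseteq> ?S - {z}"
      proof -
        have "path_image (rectpath p1 p3) = cbox p1 p3 - box p1 p3"
          by (rule path_image_rectpath_cbox_minus_box) (use z T' in \<open>auto simp: p_defs\<close>)
        moreover have "cbox p1 p3 \<subseteq> ?S" by (auto simp: in_cbox_complex_iff p_defs)
        ultimately show ?thesis using zb by blast
      qed
    qed (simp_all only: valid_path_rectpath pathfinish_rectpath pathstart_rectpath finite.emptyI)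
    then have I: "((\<lambda>w. (f w)\<^sup>2 / (w - z)) has_contour_integral (2 * pi * \<i> * (f z)\<^sup>2)) (rectpath p1 p3)"
      using winding_number_rectpath[OF zb] by simp
    have cont_h: "continuous_on (?S - {z}) ?h"
      by (intro continuous_intros continuous_on_subset[OF cont]) auto
    have ab: "a < b" using z by linarith
    have seg: "closed_segment p1 p2 \<subseteq> ?S - {z}" "closed_segment p2 p3 \<subseteq> ?S - {z}"
        "closed_segment p4 p3 \<subseteq> ?S - {z}" "closed_segment p1 p4 \<subseteq> ?S - {z}"
      using z T' ab by (auto simp: p_defs closed_segment_same_Re closed_segment_same_Im
            closed_segment_eq_real_ivl split: if_splits)
    note c_seg = seg[THEN continuous_on_subset[OF cont_h]]
    have "2 * pi * (norm (f z))\<^sup>2 = norm (contour_integral (rectpath p1 p3) ?h)"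
      using contour_integral_unique[OF I] by (simp add: norm_mult norm_power)
    also have "contour_integral (rectpath p1 p3) ?h = contour_integral (linepath p1 p2) ?h +
       contour_integral (linepath p2 p3) ?h + contour_integral (linepath p3 p4) ?h + contour_integral (linepath p4 p1) ?h"
      unfolding rectpath_def Let_def
      using c_seg by (simp add: p_defs contour_integrable_continuous_linepath closed_segment_commute add.assoc)
    also have "norm \<dots> \<le> norm (contour_integral (linepath p1 p2) ?h) + norm (contour_integral (linepath p2 p3) ?h)
          + norm (contour_integral (linepath p4 p3) ?h) + norm (contour_integral (linepath p1 p4) ?h)"
      using norm_contour_integral_linepath_commute[OF c_seg(3)] norm_contour_integral_linepath_commute[OF c_seg(4)]
      by (smt (verit) norm_triangle_ineq)
    also have "\<dots> \<le> 1 / (T - \<bar>Im z\<bar>) + B / (b - Re z) + 1 / (T - \<bar>Im z\<bar>) + A / (Re z - a)"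
    proof (intro add_mono)
      have hor: "(\<integral>\<^sup>+x. ennreal (norm (?h (Complex x s))) * indicator {a..b} x \<partial>lborel) \<le> ennreal (1 / (T - \<bar>Im z\<bar>))"
        if s: "\<bar>s\<bar> = T" and le: "(\<integral>\<^sup>+x. ennreal (F (Complex x s)) * indicator {a..b} x \<partial>lborel) \<le> 1" for s
      proof -
        have "(\<integral>\<^sup>+x. ennreal (norm (?h (Complex x s))) * indicator {a..b} x \<partial>lborel)
           \<le> (\<integral>\<^sup>+x. ennreal (1 / (T - \<bar>Im z\<bar>)) * (ennreal (F (Complex x s)) * indicator {a..b} x) \<partial>lborel)"
        proof (rule nn_integral_mono)
          fix x
          have "T - \<bar>Im z\<bar> \<le> norm (Complex x s - z)"
            using abs_Im_le_cmod[of "Complex x s - z"] s by simp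
          then have "norm (?h (Complex x s)) \<le> 1 / (T - \<bar>Im z\<bar>) * (norm (f (Complex x s)))\<^sup>2"
            using T' by (auto simp: norm_divide norm_power intro!: divide_left_mono mult_pos_pos)
          then show "ennreal (norm (?h (Complex x s))) * indicator {a..b} x
            \<le> ennreal (1 / (T - \<bar>Im z\<bar>)) * (ennreal (F (Complex x s)) * indicator {a..b} x)"
            using T' by (auto simp: indicator_def Feq ennreal_mult'[symmetric] intro!: ennreal_leI)
        qed
        also have "\<dots> = ennreal (1 / (T - \<bar>Im z\<bar>)) * (\<integral>\<^sup>+x. ennreal (F (Complex x s)) * indicator {a..b} x \<partial>lborel)"
          by (intro nn_integral_cmult) measurable
        also have "\<dots> \<le> ennreal (1 / (T - \<bar>Im z\<bar>)) * 1" by (intro mult_left_mono le) auto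
        finally show ?thesis by simp
      qed
      have ver: "(\<integral>\<^sup>+y. ennreal (norm (?h (Complex x y))) * indicator {- T..T} y \<partial>lborel) \<le> ennreal (D / d)"
        if le: "(\<integral>\<^sup>+y. ennreal ((norm (f (Complex x y)))\<^sup>2) \<partial>lborel) \<le> ennreal D" and "0 \<le> D"
          and d: "d = \<bar>x - Re z\<bar>" "d > 0" and x: "a \<le> x" "x \<le> b" for x d D
      proof -
        have "(\<integral>\<^sup>+y. ennreal (norm (?h (Complex x y))) * indicator {- T..T} y \<partial>lborel)
           \<le> (\<integral>\<^sup>+y. ennreal (1 / d) * ennreal (F (Complex x y)) \<partial>lborel)"
        proof (rule nn_integral_mono)
          fix y
          have "d \<le> norm (Complex x y - z)"
            using abs_Re_le_cmod[of "Complex x y - z"] d by simp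
          then have "norm (?h (Complex x y)) \<le> 1 / d * (norm (f (Complex x y)))\<^sup>2"
            using d by (auto simp: norm_divide norm_power intro!: divide_left_mono mult_pos_pos)
          then show "ennreal (norm (?h (Complex x y))) * indicator {- T..T} y
            \<le> ennreal (1 / d) * ennreal (F (Complex x y))"
            using d x by (auto simp: indicator_def Feq ennreal_mult'[symmetric] intro!: ennreal_leI)
        qed
        also have "\<dots> = ennreal (1 / d) * (\<integral>\<^sup>+y. ennreal (F (Complex x y)) \<partial>lborel)"
          by (intro nn_integral_cmult) measurable
        also have "\<dots> \<le> ennreal (1 / d) * ennreal D" using le x by (intro mult_left_mono) (auto simp: Feq)
        also have "\<dots> = ennreal (D / d)" using d \<open>0 \<le> D\<close> by (simp add: ennreal_mult'[symmetric])
        finally show ?thesis by simp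
      qed
      show "norm (contour_integral (linepath p1 p2) ?h) \<le> 1 / (T - \<bar>Im z\<bar>)"
        unfolding p_defs
        by (rule norm_contour_integral_horizontal_le) (use c_seg ab T' T2 hor[of "-T"] in \<open>auto simp: p_defs\<close>)
      show "norm (contour_integral (linepath p4 p3) ?h) \<le> 1 / (T - \<bar>Im z\<bar>)"
        unfolding p_defs
        by (rule norm_contour_integral_horizontal_le) (use c_seg ab T' T1 hor[of "T"] in \<open>auto simp: p_defs\<close>)
      show "norm (contour_integral (linepath p2 p3) ?h) \<le> B / (b - Re z)"
        unfolding p_defs
        by (rule norm_contour_integral_vertical_le) (use c_seg ab T' z B ver[OF B] in \<open>auto simp: p_defs\<close>)
      show "norm (contour_integral (linepath p1 p4) ?h) \<le> A / (Re z - a)"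
        unfolding p_defs
        by (rule norm_contour_integral_vertical_le) (use c_seg ab T' z A ver[OF A] in \<open>auto simp: p_defs\<close>)
    qed
    also have "\<dots> = ?C + 2 / (T - \<bar>Im z\<bar>)" by (simp add: algebra_simps)
    also have "\<dots> \<le> ?C + \<epsilon>" using T' by simp
    finally show ?thesis .
  qed
  have "2 * pi * (norm (f z))\<^sup>2 \<le> ?C" by (rule field_le_epsilon) (use key in auto)
  then show ?thesis by (simp add: field_simps)
qed

section \<open>Growth of the functions in the space\<close>

lemma closure_right_half_plane: "closure right_half_plane = {z. 0 \<le> Re z}"
  using closure_halfspace_gt[of "1::complex" 0] by (simp add: right_half_plane_def inner_complex_def)

lemma borel_measurable_vertical_slice:
  fixes f :: "complex \<Rightarrow> complex"
  assumes "continuous_on {z. 0 \<le> Re z} f" "0 \<le> x"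
  shows "(\<lambda>y. f (Complex x y)) \<in> borel_measurable borel"
  by (intro borel_measurable_continuous_onI continuous_on_compose2[OF assms(1)])
     (use assms(2) in \<open>auto simp: Complex_eq intro!: continuous_intros\<close>)

text \<open>
  On the open strip this is the definition; on the imaginary axis it follows by Fatou's lemma from
  continuity up to the axis.
\<close>
lemma H2_strip_slices_bounded:
  assumes H2: "\<forall>b>0. f \<in> H2_strip b" and cont: "continuous_on {z. 0 \<le> Re z} f" and "0 < b"
  shows "\<exists>M\<ge>0. \<forall>x. 0 \<le> x \<and> x \<le> b \<longrightarrow>
           (\<integral>\<^sup>+y. ennreal ((norm (f (Complex x y)))\<^sup>2) \<partial>lborel) \<le> ennreal M"
proof -
  define S where "S = (SUP x\<in>{0<..<b+1}. \<integral>\<^sup>+ y. ennreal ((norm (f (Complex x y)))\<^sup>2) \<partial>lborel)"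
  have "f \<in> H2_strip (b + 1)" using H2 \<open>0 < b\<close> by simp
  then have "S < \<infinity>" by (simp add: S_def H2_strip_def)
  then obtain M where M: "S = ennreal M" "M \<ge> 0" by (cases S) auto
  have inner: "(\<integral>\<^sup>+y. ennreal ((norm (f (Complex x y)))\<^sup>2) \<partial>lborel) \<le> ennreal M"
    if "0 < x" "x \<le> b" for x
    unfolding M(1)[symmetric] S_def by (rule SUP_upper) (use that in auto)
  have "(\<integral>\<^sup>+y. ennreal ((norm (f (Complex 0 y)))\<^sup>2) \<partial>lborel)
      = (\<integral>\<^sup>+y. liminf (\<lambda>n. ennreal ((norm (f (Complex (b / Suc n) y)))\<^sup>2)) \<partial>lborel)"
  proof (intro nn_integral_cong)
    fix y
    have "(\<lambda>n. Complex (b / Suc n) y) \<longlonglongrightarrow> Complex 0 y"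
      using LIMSEQ_Suc[OF lim_const_over_n[of b]] by (intro tendsto_Complex) auto
    then have "(\<lambda>n. f (Complex (b / Suc n) y)) \<longlonglongrightarrow> f (Complex 0 y)"
      using cont \<open>0 < b\<close> by (elim continuous_on_tendsto_compose) auto
    then have "(\<lambda>n. ennreal ((norm (f (Complex (b / Suc n) y)))\<^sup>2)) \<longlonglongrightarrow> ennreal ((norm (f (Complex 0 y)))\<^sup>2)"
      by (intro tendsto_intros)
    then show "ennreal ((norm (f (Complex 0 y)))\<^sup>2) = liminf (\<lambda>n. ennreal ((norm (f (Complex (b / Suc n) y)))\<^sup>2))"
      by (intro lim_imp_Liminf[symmetric]) auto
  qed
  also have "\<dots> \<le> liminf (\<lambda>n. \<integral>\<^sup>+y. ennreal ((norm (f (Complex (b / Suc n) y)))\<^sup>2) \<partial>lborel)"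
  proof (intro nn_integral_liminf)
    fix n :: nat
    have [measurable]: "(\<lambda>y. f (Complex (b / Suc n) y)) \<in> borel_measurable borel"
      using cont \<open>0 < b\<close> by (intro borel_measurable_vertical_slice) auto
    show "(\<lambda>y. ennreal ((norm (f (Complex (b / Suc n) y)))\<^sup>2)) \<in> borel_measurable lborel"
      by measurable
  qed
  also have "\<dots> \<le> ennreal M"
    using \<open>0 < b\<close>
    by (intro Liminf_le always_eventually allI inner) (auto simp: field_simps)
  finally have "(\<integral>\<^sup>+y. ennreal ((norm (f (Complex 0 y)))\<^sup>2) \<partial>lborel) \<le> ennreal M" .
  with inner M(2) show ?thesis
    by (metis order_le_less)
qed

lemma M2_omega_slice_bound:
  assumes f: "f \<in> M2_omega"
  shows "\<exists>C\<ge>0. \<forall>n\<ge>1. (\<integral>\<^sup>+y. ennreal ((norm (f (Complex (real n / 2) y)))\<^sup>2) \<partial>lborel)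
            \<le> ennreal (C * fact n / 2 ^ n)"
proof -
  from f obtain g where g: "L2_boundary_value f g"
    and fin: "(\<integral>\<^sup>+ w. ennreal ((norm (extend_to_boundary f g w))\<^sup>2) \<partial>omega) < \<infinity>"
    and hol: "f holomorphic_on right_half_plane"
    unfolding M2_omega_def by blast
  define I where "I = (\<integral>\<^sup>+ w. ennreal ((norm (extend_to_boundary f g w))\<^sup>2) \<partial>omega)"
  from fin obtain C where C: "I = ennreal C" "C \<ge> 0" unfolding I_def[symmetric] by (cases I) auto
  have [measurable]: "g \<in> borel_measurable borel" using g by (simp add: L2_boundary_value_def)
  have op: "open right_half_plane"
    unfolding right_half_plane_def by (intro open_Collect_less continuous_intros)
  have [measurable]: "(\<lambda>w. indicator right_half_plane w *\<^sub>R f w) \<in> borel_measurable borel"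
    by (intro borel_measurable_continuous_on_indicator borel_open op holomorphic_on_imp_continuous_on hol)
  have "extend_to_boundary f g = (\<lambda>w. indicator right_half_plane w *\<^sub>R f w
           + (if Re w = 0 then g (Im w) else 0))"
    by (auto simp: extend_to_boundary_def right_half_plane_def fun_eq_iff)
  then have [measurable]: "extend_to_boundary f g \<in> borel_measurable borel" by simp
  have "(\<integral>\<^sup>+y. ennreal ((norm (f (Complex (real n / 2) y)))\<^sup>2) \<partial>lborel) \<le> ennreal (C * fact n / 2 ^ n)"
    if n: "n \<ge> 1" for n
  proof -
    let ?J = "\<lambda>n. \<integral>\<^sup>+ y. ennreal ((norm (extend_to_boundary f g (Complex (real n / 2) y)))\<^sup>2) \<partial>lborel"
    have eq: "?J n = (\<integral>\<^sup>+y. ennreal ((norm (f (Complex (real n / 2) y)))\<^sup>2) \<partial>lborel)"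
      using n by (simp add: extend_to_boundary_def)
    have "I = (\<Sum>n. ennreal (2 ^ n / fact n) * ?J n)"
      unfolding I_def by (rule nn_integral_omega) measurable
    moreover have "ennreal (2 ^ n / fact n) * ?J n \<le> (\<Sum>n. ennreal (2 ^ n / fact n) * ?J n)"
      using sum_le_suminf[of "\<lambda>n. ennreal (2 ^ n / fact n) * ?J n" "{n}"] by simp
    ultimately have "ennreal (2 ^ n / fact n) * ?J n \<le> ennreal C" using C by simp
    then have "ennreal (fact n / 2 ^ n) * (ennreal (2 ^ n / fact n) * ?J n) \<le> ennreal (fact n / 2 ^ n) * ennreal C"
      by (intro mult_left_mono) auto
    moreover have "ennreal (fact n / 2 ^ n) * ennreal (2 ^ n / fact n) = 1"
      by (simp add: ennreal_mult'[symmetric])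
    ultimately have "?J n \<le> ennreal (fact n / 2 ^ n) * ennreal C"
      by (simp add: mult.assoc[symmetric])
    then show ?thesis using C(2) unfolding eq by (simp add: ennreal_mult'[symmetric] mult.commute)
  qed
  with C(2) show ?thesis by blast
qed

lemma fact_half_power_le:
  assumes "real k \<le> 2 * u" "1 \<le> u"
  shows "fact k / 2 ^ k \<le> u powr real k"
proof -
  have "(fact k :: real) \<le> real k ^ k"
    using fact_le_power[of k, where 'a = real] by simp
  also have "\<dots> \<le> (2 * u) ^ k" using assms by (intro power_mono) auto
  also have "\<dots> = 2 ^ k * u powr real k" using assms by (simp add: power_mult_distrib powr_realpow)
  finally show ?thesis by (simp add: field_simps)
qed

text \<open>
  For \<open>x = Re z \<le> 1\<close> the strip from \<open>x/2\<close> to \<open>3x/2\<close> gives \<open>O(1/x)\<close>.  For \<open>x > 1\<close> take \<open>n\<close>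
  with \<open>n/2 \<le> x < (n+1)/2\<close> and the strip from \<open>(n-1)/2\<close> to \<open>(n+2)/2\<close>, both of whose sides are at
  distance at least \<open>1/2\<close>: the square means there are \<open>O(k!/2\<^sup>k)\<close> with \<open>k \<le> 2x + 2\<close>, hence at most
  \<open>R powr (2 * x)\<close> up to an exponential in \<open>x\<close>.
\<close>
lemma M2_omega_growth:
  assumes f: "f \<in> M2_omega" and cont: "continuous_on {z. 0 \<le> Re z} f"
  shows "\<exists>C\<ge>0. \<forall>R z. 0 < Re z \<longrightarrow> Re z \<le> R \<longrightarrow> 1 \<le> R \<longrightarrow>
           (norm (f z))\<^sup>2 \<le> C / Re z * exp (C * Re z) * R powr (2 * Re z)"
proof -
  have H2: "\<forall>b>0. f \<in> H2_strip b" and hol: "f holomorphic_on right_half_plane"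
    using f by (auto simp: M2_omega_def)
  obtain M where M: "M \<ge> 0" "\<And>x. 0 \<le> x \<Longrightarrow> x \<le> 2 \<Longrightarrow>
           (\<integral>\<^sup>+y. ennreal ((norm (f (Complex x y)))\<^sup>2) \<partial>lborel) \<le> ennreal M"
    using H2_strip_slices_bounded[OF H2 cont, of 2] by auto
  obtain C where C: "C \<ge> 0" "\<And>n. n \<ge> 1 \<Longrightarrow> 
        (\<integral>\<^sup>+y. ennreal ((norm (f (Complex (real n / 2) y)))\<^sup>2) \<partial>lborel) \<le> ennreal (C * fact n / 2 ^ n)"
    using M2_omega_slice_bound[OF f] by auto
  define K where "K = max M (max (5 * C) 5)"
  have "(norm (f z))\<^sup>2 \<le> K / Re z * exp (K * Re z) * R powr (2 * Re z)"
    if z: "0 < Re z" "Re z \<le> R" and R: "1 \<le> R" for R z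
  proof -
    define x where "x = Re z"
    have strip: "(norm (f z))\<^sup>2 \<le> (A / (x - a) + B / (b - x)) / (2 * pi)"
      if "0 \<le> a" "a < x" "x < b" "0 \<le> A" "0 \<le> B"
       "(\<integral>\<^sup>+y. ennreal ((norm (f (Complex a y)))\<^sup>2) \<partial>lborel) \<le> ennreal A" 
       "(\<integral>\<^sup>+y. ennreal ((norm (f (Complex b y)))\<^sup>2) \<partial>lborel) \<le> ennreal B" for a b A B
    proof -
      obtain N where N: "N \<ge> 0" "\<And>x. 0 \<le> x \<Longrightarrow> x \<le> b \<Longrightarrow>
           (\<integral>\<^sup>+y. ennreal ((norm (f (Complex x y)))\<^sup>2) \<partial>lborel) \<le> ennreal N"
        using H2_strip_slices_bounded[OF H2 cont, of b] \<open>0 \<le> a\<close> \<open>a < x\<close> \<open>x < b\<close> by force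
      show ?thesis unfolding x_def
        by (rule square_bound_in_strip[where M = N])
           (use that N in \<open>auto simp: x_def right_half_plane_def intro: continuous_on_subset[OF cont]
              holomorphic_on_subset[OF hol]\<close>)
    qed
    have pi1: "2 \<le> pi" using pi_ge_two .
    have "(norm (f z))\<^sup>2 \<le> K / x * exp (K * x) * R powr (2 * x)"
    proof (cases "x \<le> 1")
      case True
      have "(norm (f z))\<^sup>2 \<le> (M / (x - x / 2) + M / (3 * x / 2 - x)) / (2 * pi)"
        using z True by (intro strip M) (auto simp: x_def)
      also have "\<dots> = M / x * (2 / pi)" using z by (simp add: x_def field_simps)
      also have "\<dots> \<le> M / x * 1"
        using M(1) z pi1 by (intro mult_left_mono) (auto simp: x_def)
      also have "\<dots> \<le> K / x * 1" using z by (simp add: x_def divide_right_mono K_def)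
      also have "\<dots> \<le> K / x * (exp (K * x) * R powr (2 * x))"
      proof (intro mult_left_mono)
        have "1 \<le> exp (K * x)" using z by (simp add: x_def K_def)
        moreover have "1 \<le> R powr (2 * x)" using R z by (simp add: x_def ge_one_powr_ge_zero)
        ultimately show "1 \<le> exp (K * x) * R powr (2 * x)"
          by (metis mult_mono' mult_1 zero_le_one)
        show "0 \<le> K / x" using z by (simp add: x_def K_def)
      qed
      finally show ?thesis by (simp add: mult.assoc)
    next
      case False
      define n where "n = nat \<lfloor>2 * x\<rfloor>"
      have n: "2 \<le> n" "real n \<le> 2 * x" "2 * x < real n + 1"
        using False by (auto simp: n_def le_nat_iff le_floor_iff)
      define A B where "A = C * fact (n - 1) / 2 ^ (n - 1)" and "B = C * fact (n + 2) / 2 ^ (n + 2)"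
      have AB: "A \<ge> 0" "B \<ge> 0" using C(1) by (simp_all add: A_def B_def)
      have "(norm (f z))\<^sup>2 \<le> (A / (x - real (n - 1) / 2) + B / (real (n + 2) / 2 - x)) / (2 * pi)"
        using n AB C(2)[of "n - 1"] C(2)[of "n + 2"]
        by (intro strip) (auto simp: A_def B_def of_nat_diff)
      also have "\<dots> \<le> (A / (1 / 2) + B / (1 / 2)) / (2 * pi)"
      proof -
        have "1 / 2 \<le> x - real (n - 1) / 2" "1 / 2 \<le> real (n + 2) / 2 - x"
          using n by (simp_all add: of_nat_diff field_simps)
        then show ?thesis
          using n AB by (intro divide_right_mono add_mono divide_left_mono mult_pos_pos) (simp | linarith)+
      qed
      also have "\<dots> = (A + B) * (1 / pi)" by (simp add: field_simps)
      also have "\<dots> \<le> (A + B) * 1" using AB pi1 by (intro mult_left_mono) auto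
      also have "A \<le> C * R powr (2 * x)"
      proof -
        have "fact (n - 1) / 2 ^ (n - 1) \<le> x powr real (n - 1)"
          using n False by (intro fact_half_power_le) auto
        also have "\<dots> \<le> x powr (2 * x)" using n False by (intro powr_mono) auto
        also have "\<dots> \<le> R powr (2 * x)" using z False by (intro powr_mono2) (auto simp: x_def)
        finally show ?thesis unfolding A_def
          using C(1) by (metis mult_left_mono times_divide_eq_right)
      qed
      also have "B \<le> C * (4 * exp (4 * x) * R powr (2 * x))"
      proof -
        have "fact (n + 2) / 2 ^ (n + 2) \<le> (2 * x) powr real (n + 2)"
          using n False by (intro fact_half_power_le) auto
        also have "\<dots> \<le> (2 * x) powr (2 * x + 2)" using n False by (intro powr_mono) auto
        also have "\<dots> = 2 powr (2 * x) * 4 * x\<^sup>2 * x powr (2 * x)"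
          using False by (simp add: powr_mult powr_add)
        also have "\<dots> \<le> exp (2 * x) * 4 * exp (2 * x) * R powr (2 * x)"
        proof (intro mult_mono)
          show "2 powr (2 * x) \<le> exp (2 * x)"
            using False ln_2_less_1 by (simp add: powr_def)
          have "x \<le> exp x" using exp_ge_add_one_self[of x] by linarith
          then have "x\<^sup>2 \<le> (exp x)\<^sup>2" using False by (intro power_mono) auto
          then show "x\<^sup>2 \<le> exp (2 * x)" by (simp add: exp_double)
          show "x powr (2 * x) \<le> R powr (2 * x)" using z False by (intro powr_mono2) (auto simp: x_def)
        qed (use False in auto)
        also have "\<dots> = 4 * exp (4 * x) * R powr (2 * x)"
          by (simp add: exp_add[symmetric])
        finally show ?thesis unfolding B_def
          using C(1) by (metis mult_left_mono times_divide_eq_right)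
      qed
      also have "C * R powr (2 * x) + C * (4 * exp (4 * x) * R powr (2 * x))
          \<le> C * (exp (4 * x) * R powr (2 * x)) + C * (4 * exp (4 * x) * R powr (2 * x))"
        using C(1) False mult_right_mono[of 1 "exp (4 * x)" "R powr (2 * x)"]
        by (intro add_right_mono mult_left_mono) auto
      also have "\<dots> = 5 * C * (exp (4 * x) * 1) * R powr (2 * x)" by (simp add: algebra_simps)
      also have "\<dots> \<le> 5 * C * (exp (4 * x) * (exp x / x)) * R powr (2 * x)"
      proof -
        have "x \<le> exp x" using exp_ge_add_one_self[of x] by linarith
        then show ?thesis using C(1) False by (intro mult_right_mono mult_left_mono) (auto simp: field_simps)
      qed
      also have "\<dots> = 5 * C / x * exp (5 * x) * R powr (2 * x)"
        by (simp add: exp_add[symmetric] field_simps)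
      also have "\<dots> \<le> K / x * exp (K * x) * R powr (2 * x)"
        using False C(1) by (intro mult_mono divide_right_mono) (auto simp: K_def)
      finally show ?thesis by simp
    qed
    then show ?thesis by (simp add: x_def)
  qed
  moreover have "K \<ge> 0" by (simp add: K_def)
  ultimately show ?thesis by blast
qed

section \<open>Blaschke factors and Cauchy's formula on a half-disc\<close>

text \<open>
  Only positivity of the winding number of the boundary is needed: being an integer it is then at least 1 in
  modulus, which suffices for an upper bound on \<open>\<Phi>\<close>.
\<close>
lemma half_disc_Cauchy_bound:
  assumes cont: "continuous_on {w. 0 \<le> Re w \<and> norm w \<le> R} \<Phi>"
    and hol: "\<Phi> holomorphic_on {w. 0 < Re w \<and> norm w < R}"
    and x0: "0 < x0" "x0 < R"
    and axis: "(\<integral>\<^sup>+y. ennreal (norm (\<Phi> (Complex 0 y))) * indicator {-R..R} y \<partial>lborel) \<le> ennreal A" "0 \<le> A"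
    and arc: "\<And>w. 0 \<le> Re w \<Longrightarrow> norm w = R \<Longrightarrow> norm (\<Phi> w) \<le> K" "0 \<le> K"
  shows "2 * pi * norm (\<Phi> (of_real x0)) \<le> A / x0 + pi * R * K / (R - x0)"
proof -
  let ?S = "{w. 0 \<le> Re w \<and> norm w \<le> R}" and ?I = "{w. 0 < Re w \<and> norm w < R}"
  let ?z = "of_real x0 :: complex"
  let ?h = "\<lambda>w. \<Phi> w / (w - ?z)"
  have R: "R > 0" using x0 by simp
  have opI: "open ?I" by (intro open_Collect_conj open_Collect_less continuous_intros)
  have Sint: "?S = {w. 0 \<le> Re w} \<inter> cball 0 R" by auto
  have convS: "convex ?S" unfolding Sint by (intro convex_Int convex_halfspace_Re_ge convex_cball)
  have IS: "interior ?S \<subseteq> ?I"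
  proof
    fix x assume x: "x \<in> interior ?S"
    then obtain e where e: "e > 0" "cball x e \<subseteq> ?S" by (auto simp: mem_interior_cball)
    have "x - of_real e \<in> cball x e" using e by (auto simp: dist_norm)
    then have "0 < Re x" using e by fastforce
    moreover have "norm x < R"
      using x interior_mono[of ?S "cball 0 R"] by (auto simp: Sint)
    ultimately show "x \<in> ?I" by simp
  qed
  have SI: "?I \<subseteq> interior ?S" by (rule interior_maximal[OF _ opI]) auto
  let ?arc = "part_circlepath 0 R (-pi/2) (pi/2)" and ?seg = "linepath (Complex 0 R) (Complex 0 (-R))"
  have ends: "pathfinish ?arc = Complex 0 R" "pathstart ?arc = Complex 0 (-R)"
    by (simp_all only: pathfinish_part_circlepath pathstart_part_circlepath cis_conv_exp[symmetric])
       (simp_all add: complex_eq_iff)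
  define \<gamma> where "\<gamma> = ?arc +++ ?seg"
  have arc_img: "path_image ?arc \<subseteq> {w. 0 \<le> Re w \<and> norm w = R}"
  proof -
    have "path_image ?arc \<subseteq> sphere 0 R" using R by (intro path_image_part_circlepath_subset') auto
    moreover have "0 \<le> Re w" if "w \<in> path_image ?arc" for w
      using that R cos_ge_zero
      by (auto simp: path_image_part_circlepath' closed_segment_eq_real_ivl)
    ultimately show ?thesis by auto
  qed
  have seg_img: "closed_segment (Complex 0 (-R)) (Complex 0 R) = {w. Re w = 0 \<and> -R \<le> Im w \<and> Im w \<le> R}"
    using R by (auto simp: closed_segment_same_Re closed_segment_eq_real_ivl)
  have segS: "closed_segment (Complex 0 (-R)) (Complex 0 R) \<subseteq> ?S - {?z}"
    unfolding seg_img using x0 by (auto simp: cmod_eq_Im)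
  have arcS: "path_image ?arc \<subseteq> ?S - {?z}"
    using arc_img x0 by auto
  have imgS: "path_image \<gamma> \<subseteq> ?S - {?z}"
    unfolding \<gamma>_def
    using path_image_join_subset[of ?arc ?seg] arcS segS by (auto simp: closed_segment_commute)
  have vp: "valid_path \<gamma>" unfolding \<gamma>_def
    by (intro valid_path_join valid_path_part_circlepath valid_path_linepath) (use ends in simp)
  have loop: "pathfinish \<gamma> = pathstart \<gamma>" unfolding \<gamma>_def using ends by simp
  have "valid_path (?arc +++ ?seg) \<and> ?z \<notin> path_image (?arc +++ ?seg) \<and> 0 < Re (winding_number (?arc +++ ?seg) ?z)"
  proof (rule winding_number_join_pos_combined)
    show "?z \<notin> path_image ?arc" using arcS by blast
    show "?z \<notin> path_image ?seg" using segS by (simp add: closed_segment_commute) blast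
    show "0 < Re (winding_number ?arc ?z)"
      using x0 by (intro winding_number_part_circlepath_pos_less) auto
    show "0 < Re (winding_number ?seg ?z)"
      using x0 R by (intro winding_number_linepath_pos_lt) auto
  qed (use ends in auto)
  then have wpos: "0 < Re (winding_number \<gamma> ?z)" by (simp add: \<gamma>_def)
  have "winding_number \<gamma> ?z \<in> \<int>"
    using vp loop imgS by (intro integer_winding_number valid_path_imp_path) auto
  with wpos have w1: "1 \<le> norm (winding_number \<gamma> ?z)" by (auto simp: Ints_def)
  have "((\<lambda>w. \<Phi> w / (w - ?z)) has_contour_integral (2 * pi * \<i> * winding_number \<gamma> ?z * \<Phi> ?z)) \<gamma>"
  proof (rule Cauchy_integral_formula_weak[where k = "{}", OF convS])
    show "\<Phi> field_differentiable at x" if "x \<in> interior ?S - {}" for x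
      using that IS hol opI holomorphic_on_imp_differentiable_at by blast
    show "?z \<in> interior ?S - {}" using SI x0 by auto
  qed (use cont imgS vp loop in auto)
  then have "norm (contour_integral \<gamma> ?h) = 2 * pi * norm (winding_number \<gamma> ?z) * norm (\<Phi> ?z)"
    by (simp add: contour_integral_unique norm_mult)
  moreover have "2 * pi * 1 * norm (\<Phi> ?z) \<le> 2 * pi * norm (winding_number \<gamma> ?z) * norm (\<Phi> ?z)"
    using w1 by (intro mult_right_mono mult_left_mono) auto
  ultimately have lower: "2 * pi * norm (\<Phi> ?z) \<le> norm (contour_integral \<gamma> ?h)" by simp
  have cont_h: "continuous_on (?S - {?z}) ?h"
    by (intro continuous_intros continuous_on_subset[OF cont]) auto
  have int_arc: "?h contour_integrable_on ?arc"
    by (intro contour_integrable_continuous_part_circlepath continuous_on_subset[OF cont_h] arcS)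
  have int_seg: "?h contour_integrable_on ?seg"
    using continuous_on_subset[OF cont_h segS]
    by (intro contour_integrable_continuous_linepath) (simp add: closed_segment_commute)
  have "contour_integral \<gamma> ?h = contour_integral ?arc ?h + contour_integral ?seg ?h"
    unfolding \<gamma>_def using int_arc int_seg ends
    by (intro contour_integral_join valid_path_part_circlepath valid_path_linepath) auto
  then have upper: "norm (contour_integral \<gamma> ?h) \<le> norm (contour_integral ?arc ?h) + norm (contour_integral ?seg ?h)"
    by (simp only: norm_triangle_ineq)
  have arc_le: "norm (contour_integral ?arc ?h) \<le> K / (R - x0) * R * \<bar>pi / 2 - (- pi / 2)\<bar>"
  proof (rule contour_integral_bound_part_circlepath[OF int_arc])
    fix w assume "w \<in> path_image ?arc"
    then have w: "0 \<le> Re w" "norm w = R" using arc_img by auto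
    have "R - x0 \<le> norm (w - ?z)" using norm_triangle_ineq2[of w ?z] w x0 by simp
    then show "norm (?h w) \<le> K / (R - x0)"
      using arc w x0 by (auto simp: norm_divide intro!: frac_le)
  qed (use R arc x0 in auto)
  have seg_le: "norm (contour_integral ?seg ?h) \<le> A / x0"
  proof -
    have "norm (contour_integral ?seg ?h) = norm (contour_integral (linepath (Complex 0 (-R)) (Complex 0 R)) ?h)"
      by (intro norm_contour_integral_linepath_commute continuous_on_subset[OF cont_h segS])
    also have "\<dots> \<le> A / x0"
    proof (rule norm_contour_integral_vertical_le[OF continuous_on_subset[OF cont_h segS]])
      have meas: "(\<lambda>y. ennreal (norm (\<Phi> (Complex 0 y))) * indicator {-R..R} y) \<in> borel_measurable borel"
      proof -
        have c: "continuous_on {-R..R} (\<lambda>y. \<Phi> (Complex 0 y))"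
          by (rule continuous_on_compose2[OF cont])
             (auto simp: Complex_eq norm_mult intro!: continuous_intros)
        have [measurable]: "(\<lambda>y. indicator {-R..R} y *\<^sub>R \<Phi> (Complex 0 y)) \<in> borel_measurable borel"
          by (intro borel_measurable_continuous_on_indicator c) auto
        have "(\<lambda>y. ennreal (norm (\<Phi> (Complex 0 y))) * indicator {-R..R} y)
           = (\<lambda>y. ennreal (norm (indicator {-R..R} y *\<^sub>R \<Phi> (Complex 0 y))))"
          by (auto simp: fun_eq_iff indicator_def)
        then show ?thesis by (simp only:) measurable
      qed
      have "(\<integral>\<^sup>+y. ennreal (norm (?h (Complex 0 y))) * indicator {-R..R} y \<partial>lborel)
          \<le> (\<integral>\<^sup>+y. ennreal (1 / x0) * (ennreal (norm (\<Phi> (Complex 0 y))) * indicator {-R..R} y) \<partial>lborel)"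
      proof (rule nn_integral_mono)
        fix y
        have "x0 \<le> norm (Complex 0 y - ?z)"
          using abs_Re_le_cmod[of "Complex 0 y - ?z"] x0 by simp
        then have "norm (?h (Complex 0 y)) \<le> 1 / x0 * norm (\<Phi> (Complex 0 y))"
          using x0 by (auto simp: norm_divide intro!: divide_left_mono mult_pos_pos)
        then have "ennreal (norm (?h (Complex 0 y))) \<le> ennreal (1 / x0) * ennreal (norm (\<Phi> (Complex 0 y)))"
          using x0 by (simp add: ennreal_mult'[symmetric] ennreal_leI)
        then show "ennreal (norm (?h (Complex 0 y))) * indicator {-R..R} y
           \<le> ennreal (1 / x0) * (ennreal (norm (\<Phi> (Complex 0 y))) * indicator {-R..R} y)"
          by (simp add: indicator_def)
      qed
      also have "\<dots> = ennreal (1 / x0) * (\<integral>\<^sup>+y. ennreal (norm (\<Phi> (Complex 0 y))) * indicator {-R..R} y \<partial>lborel)"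
        by (intro nn_integral_cmult) (use meas in simp)
      also have "\<dots> \<le> ennreal (1 / x0) * ennreal A" by (intro mult_left_mono axis) auto
      also have "\<dots> = ennreal (A / x0)" using x0 axis(2) by (simp add: ennreal_mult'[symmetric])
      finally show "(\<integral>\<^sup>+y. ennreal (norm (?h (Complex 0 y))) * indicator {-R..R} y \<partial>lborel) \<le> ennreal (A / x0)" .
    qed (use R x0 axis in auto)
    finally show ?thesis .
  qed
  have "K / (R - x0) * R * \<bar>pi / 2 - (- pi / 2)\<bar> = pi * R * K / (R - x0)" by (simp add: field_simps)
  with lower upper arc_le seg_le show ?thesis by linarith
qed

text \<open>
  The multiplicity hypothesis is stated for the part of the zeros listed by \<open>J\<close>, so that the induction can divide
  them out one at a time.
\<close>
lemma factor_out_zeros: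
  assumes "finite J" "open U" "f holomorphic_on U" "\<And>j. j \<in> J \<Longrightarrow> z j \<in> U"
    and "\<And>j. j \<in> J \<Longrightarrow> eventually (\<lambda>w. f w \<noteq> 0) (at (z j))"
    and "\<And>j. j \<in> J \<Longrightarrow> int (card {i\<in>J. z i = z j}) \<le> zorder f (z j)"
  shows "\<exists>h. h holomorphic_on U \<and> (\<forall>w\<in>U. f w = h w * (\<Prod>j\<in>J. w - z j))"
  using assms
proof (induction J arbitrary: f rule: finite_induct)
  case empty
  then show ?case by auto
next
  case (insert k J)
  define a where "a = z k"
  have aU: "a \<in> U" using insert.prems by (auto simp: a_def)
  define h where "h = (\<lambda>w. if w = a then deriv f a else (f w - f a) / (w - a))"
  have holh: "h holomorphic_on U" unfolding h_def by (rule pole_lemma_open) (use insert.prems in auto)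
  have an: "f analytic_on {b}" "h analytic_on {b}" if "b \<in> U" for b
    using that holh insert.prems analytic_at by blast+
  have card_pos: "0 < card {i \<in> insert k J. z i = a}"
    using insert.hyps by (subst card_gt_0_iff) (auto simp: a_def)
  have "0 < zorder f a"
    using insert.prems(5)[of k] card_pos by (simp add: a_def)
  then have fa: "f a = 0"
    using zorder_pos_iff'[OF an(1)[OF aU]] insert.prems(4)[of k] eventually_frequently[of "at a"]
    by (auto simp: a_def)
  have feq: "f w = (w - a) * h w" for w by (simp add: h_def fa)
  have "\<exists>h'. h' holomorphic_on U \<and> (\<forall>w\<in>U. h w = h' w * (\<Prod>j\<in>J. w - z j))"
  proof (rule insert.IH)
    fix j assume j: "j \<in> J"
    have ev: "eventually (\<lambda>w. f w \<noteq> 0) (at (z j))" using insert.prems j by auto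
    then show "eventually (\<lambda>w. h w \<noteq> 0) (at (z j))"
      by eventually_elim (auto simp: feq)
    have "zorder f (z j) = zorder (\<lambda>w. (w - a) * h w) (z j)" by (simp add: feq[abs_def])
    also have "\<dots> = zorder (\<lambda>w. w - a) (z j) + zorder h (z j)"
      by (rule zorder_times_analytic) (use an insert.prems j ev in \<open>auto simp: feq[symmetric] intro!: analytic_intros\<close>)
    also have "zorder (\<lambda>w. w - a) (z j) = (if z j = a then 1 else 0)"
    proof (cases "z j = a")
      case True
      then show ?thesis
        by (auto intro!: zorder_eqI[of UNIV _ "\<lambda>_. 1"] holomorphic_intros)
    next
      case False
      then show ?thesis by (auto intro!: zorder_eq_0I analytic_intros)
    qed
    finally have zo: "zorder f (z j) = (if z j = a then 1 else 0) + zorder h (z j)" .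
    have "{i \<in> insert k J. z i = z j} = (if z j = a then insert k {i \<in> J. z i = z j} else {i \<in> J. z i = z j})"
      by (auto simp: a_def)
    then have "card {i \<in> insert k J. z i = z j} = (if z j = a then 1 else 0) + card {i \<in> J. z i = z j}"
      using insert.hyps by (auto simp: card_insert_if)
    with zo insert.prems(5)[of j] j show "int (card {i \<in> J. z i = z j}) \<le> zorder h (z j)"
      by (auto split: if_splits)
  qed (use insert.prems holh in auto)
  then obtain h' where "h' holomorphic_on U" "\<forall>w\<in>U. h w = h' w * (\<Prod>j\<in>J. w - z j)" by blast
  then show ?case
    using insert.hyps by (intro exI[of _ h']) (auto simp: feq a_def mult_ac)
qed

text \<open>
  The Blaschke factor of the half-disc \<open>Re w > 0, |w| < R\<close> for a zero \<open>a\<close> is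
  \<open>(w - a) / reflected_factor R a w\<close>.  Its poles are the images of \<open>a\<close> under the reflections in
  the axis and in the circle, and its other zero is the image of \<open>a\<close> under both.
\<close>
definition reflected_factor :: "real \<Rightarrow> complex \<Rightarrow> complex \<Rightarrow> complex" where
  "reflected_factor R a w = (w + cnj a) * (of_real (R\<^sup>2) - cnj a * w) / (of_real (R\<^sup>2) + a * w)"

lemma reflected_factor_denominator_nonzero:
  assumes "0 < Re a" "0 \<le> Re w" "R > 0"
  shows "of_real (R\<^sup>2) + a * w \<noteq> 0"
proof
  assume "of_real (R\<^sup>2) + a * w = 0"
  then have "cnj a * (of_real (R\<^sup>2) + a * w) = 0" by simp
  then have "cnj a * of_real (R\<^sup>2) + of_real ((norm a)\<^sup>2) * w = 0"
    by (simp only: complex_norm_square) (simp add: algebra_simps)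
  then have "Re (cnj a * of_real (R\<^sup>2) + of_real ((norm a)\<^sup>2) * w) = 0" by simp
  then have "Re a * R\<^sup>2 + (norm a)\<^sup>2 * Re w = 0" by (simp del: of_real_power)
  moreover have "Re a * R\<^sup>2 > 0" "(norm a)\<^sup>2 * Re w \<ge> 0" using assms by auto
  ultimately show False by linarith
qed

lemma norm_reflected_factor_axis:
  assumes "0 < Re a" "Re w = 0" "R > 0"
  shows "norm (reflected_factor R a w) = norm (w - a)"
proof -
  have cw: "cnj w = - w" using assms by (simp add: complex_eq_iff)
  have "norm (w + cnj a) = norm (cnj (w + cnj a))" by (rule complex_mod_cnj[symmetric])
  also have "cnj (w + cnj a) = - (w - a)" by (simp add: cw)
  finally have 1: "norm (w + cnj a) = norm (w - a)" by (simp add: norm_minus_commute)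
  have "norm (of_real (R\<^sup>2) - cnj a * w) = norm (cnj (of_real (R\<^sup>2) - cnj a * w))" by (rule complex_mod_cnj[symmetric])
  also have "cnj (of_real (R\<^sup>2) - cnj a * w) = of_real (R\<^sup>2) + a * w" by (simp add: cw)
  finally show ?thesis
    using 1 reflected_factor_denominator_nonzero[of a w R] assms
    by (simp add: reflected_factor_def norm_mult norm_divide del: of_real_power)
qed

lemma norm_reflected_factor_arc:
  assumes "0 < Re a" "0 \<le> Re w" "norm w = R" "R > 0"
  shows "norm (reflected_factor R a w) = norm (w - a)"
proof -
  have R2: "of_real (R\<^sup>2) = w * cnj w"
    using assms by (metis complex_norm_square)
  have "of_real (R\<^sup>2) - cnj a * w = w * cnj (w - a)" "of_real (R\<^sup>2) + a * w = w * cnj (w + cnj a)"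
    by (simp_all only: R2) (simp_all add: algebra_simps)
  then have n: "norm (of_real (R\<^sup>2) - cnj a * w) = R * norm (w - a)"
       "norm (of_real (R\<^sup>2) + a * w) = R * norm (w + cnj a)"
    using assms by (simp_all add: norm_mult del: complex_cnj_add complex_cnj_diff)
  moreover have "norm (w + cnj a) \<noteq> 0"
    using reflected_factor_denominator_nonzero[of a w R] n(2) assms by auto
  ultimately show ?thesis using assms
    by (simp add: reflected_factor_def norm_mult norm_divide del: of_real_power)
qed

lemma exp_le_cayley:
  fixes s :: real
  assumes "0 \<le> s" "s < 1"
  shows "exp (2 * s) \<le> (1 + s) / (1 - s)"
proof -
  let ?\<phi> = "\<lambda>t::real. 1 + t - (1 - t) * exp (2 * t)"
  have "?\<phi> 0 \<le> ?\<phi> s"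
  proof (rule DERIV_nonneg_imp_nondecreasing[OF assms(1)])
    fix t :: real
    have "(?\<phi> has_real_derivative 1 - (1 - 2 * t) * exp (2 * t)) (at t)"
      by (auto intro!: derivative_eq_intros simp: algebra_simps)
    moreover have "(1 - 2 * t) * exp (2 * t) \<le> exp (- 2 * t) * exp (2 * t)"
      using exp_ge_add_one_self[of "- 2 * t"] by (intro mult_right_mono) auto
    ultimately show "\<exists>y. (?\<phi> has_real_derivative y) (at t) \<and> 0 \<le> y"
      by (force simp: exp_add[symmetric])
  qed
  then show ?thesis using assms by (simp add: field_simps)
qed

text \<open>
  The quotient \<open>(1 + p)(1 - q) / ((1 - p)(1 + q))\<close> is \<open>(1 + s)/(1 - s)\<close> for
  \<open>s = (p - q)/(1 - p q) \<ge> p - q\<close>.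
\<close>
lemma exp_le_cayley_quotient:
  fixes p q :: real
  assumes "0 \<le> q" "q \<le> p" "p < 1"
  shows "exp (2 * (p - q)) * ((1 - p) * (1 + q)) \<le> (1 + p) * (1 - q)"
proof -
  define s where "s = (p - q) / (1 - p * q)"
  have pq: "p * q < 1" "0 \<le> p * q"
    using assms mult_mono[of p 1 q q] by (auto intro: order.strict_trans1[of _ q])
  have pos: "(1 - p) * (1 + q) > 0" using assms by simp
  have s1: "s < 1" using pq pos by (simp add: s_def field_simps)
  have s0: "p - q \<le> s" "0 \<le> s"
  proof -
    have "(p - q) * (1 - p * q) \<le> (p - q) * 1" using assms pq by (intro mult_left_mono) auto
    then show "p - q \<le> s" using pq by (simp add: s_def pos_le_divide_eq)
    then show "0 \<le> s" using assms by linarith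
  qed
  have "exp (2 * (p - q)) \<le> exp (2 * s)" using s0 by simp
  also have "\<dots> \<le> (1 + s) / (1 - s)" using s0 s1 by (intro exp_le_cayley)
  also have "\<dots> = ((1 + p) * (1 - q)) / ((1 - p) * (1 + q))"
  proof -
    have "1 + s = (1 + p) * (1 - q) / (1 - p * q)" "1 - s = (1 - p) * (1 + q) / (1 - p * q)"
      using pq by (simp_all add: s_def field_simps)
    then show ?thesis using pq by simp
  qed
  finally show ?thesis using pos by (simp add: pos_le_divide_eq)
qed

text \<open>
  The squared moduli at \<open>1/4\<close> form the quotient of the previous lemma, with
  \<open>p = (Re a/2)/(1/16 + |a|\<^sup>2)\<close> coming from the reflection in the axis and
  \<open>q = (R\<^sup>2 Re a/2)/(R\<^sup>4 + |a|\<^sup>2/16)\<close> from that in the circle.  Since \<open>1 \<le> |a| \<le> R/4\<close>,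
  \<open>2(p - q)\<close> is at least \<open>(16/17 - 1/16) Re (1/a)\<close>, and \<open>16/17 - 1/16 = 239/272\<close>.
\<close>
lemma norm_reflected_factor_ge:
  assumes "0 < Re a" "1 \<le> norm a" "4 * norm a \<le> R"
  shows "exp (239 / 272 * Re (1 / a)) * (norm (1 / 4 - a))\<^sup>2 \<le> (norm (reflected_factor R a (1 / 4)))\<^sup>2"
proof -
  define r \<alpha> P where "r = (norm a)\<^sup>2" and "\<alpha> = Re a" and "P = R\<^sup>2"
  have r: "r = \<alpha>\<^sup>2 + (Im a)\<^sup>2" by (simp add: r_def \<alpha>_def cmod_power2)
  have r1: "r \<ge> 1" using assms by (simp add: r_def)
  have Rr: "16 * r \<le> P"
    using power_mono[OF assms(3), of 2] by (simp add: r_def P_def power_mult_distrib)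
  have \<alpha>: "\<alpha> > 0" "\<alpha>\<^sup>2 \<le> r" using assms r by (auto simp: \<alpha>_def)
  define p q where "p = \<alpha> / 2 / (1 / 16 + r)" and "q = P * \<alpha> / 2 / (P\<^sup>2 + r / 16)"
  have Rpos: "P > 0" using Rr r1 by linarith
  have "1 / 16 + r \<noteq> 0" using r1 by linarith
  then have "(1 / 16 + r) * p = \<alpha> / 2" unfolding p_def by (metis nonzero_mult_div_cancel_left times_divide_eq_right)
  then have p': "(1 / 16 + r) * (1 - p) = 1 / 16 + r - \<alpha> / 2" "(1 / 16 + r) * (1 + p) = 1 / 16 + r + \<alpha> / 2"
    by (simp_all only: right_diff_distrib distrib_left mult_1_right)
  have "(norm (1 / 4 - a))\<^sup>2 = (1 / 4 - \<alpha>)\<^sup>2 + (Im a)\<^sup>2"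
    by (simp only: cmod_power2) (simp add: \<alpha>_def)
  also have "\<dots> = 1 / 16 + r - \<alpha> / 2" unfolding r by (simp add: power2_eq_square field_simps)
  finally have n1: "(norm (1 / 4 - a))\<^sup>2 = (1 / 16 + r) * (1 - p)" by (simp only: p')
  have "(norm (1 / 4 + cnj a))\<^sup>2 = (1 / 4 + \<alpha>)\<^sup>2 + (Im a)\<^sup>2"
    by (simp only: cmod_power2) (simp add: \<alpha>_def)
  also have "\<dots> = 1 / 16 + r + \<alpha> / 2" unfolding r by (simp add: power2_eq_square field_simps)
  finally have n2: "(norm (1 / 4 + cnj a))\<^sup>2 = (1 / 16 + r) * (1 + p)" by (simp only: p')
  have D: "P\<^sup>2 + r / 16 > 0" using Rpos r1 by (intro add_pos_nonneg) auto
  have "(P\<^sup>2 + r / 16) * q = P * \<alpha> / 2"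
    unfolding q_def using D by (metis nonzero_mult_div_cancel_left times_divide_eq_right less_irrefl)
  then have q': "(P\<^sup>2 + r / 16) * (1 - q) = P\<^sup>2 + r / 16 - P * \<alpha> / 2"
      "(P\<^sup>2 + r / 16) * (1 + q) = P\<^sup>2 + r / 16 + P * \<alpha> / 2"
    by (simp_all only: right_diff_distrib distrib_left mult_1_right)
  have n3: "(norm (of_real (P) - cnj a * (1 / 4)))\<^sup>2 = (P\<^sup>2 + r / 16) * (1 - q)"
  proof -
    have "(norm (of_real (P) - cnj a * (1 / 4)))\<^sup>2 = (P - \<alpha> / 4)\<^sup>2 + (Im a / 4)\<^sup>2"
      by (simp add: cmod_power2 \<alpha>_def del: of_real_power)
    then show ?thesis
      unfolding q' by (simp add: r power2_eq_square field_simps)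
  qed
  have n4: "(norm (of_real (P) + a * (1 / 4)))\<^sup>2 = (P\<^sup>2 + r / 16) * (1 + q)"
  proof -
    have "(norm (of_real (P) + a * (1 / 4)))\<^sup>2 = (P + \<alpha> / 4)\<^sup>2 + (Im a / 4)\<^sup>2"
      by (simp add: cmod_power2 \<alpha>_def del: of_real_power)
    then show ?thesis
      unfolding q' by (simp add: r power2_eq_square field_simps)
  qed
  have q0: "q \<ge> 0" unfolding q_def using \<alpha> D Rpos by (intro divide_nonneg_pos mult_nonneg_nonneg) auto
  have q_le: "q \<le> \<alpha> / (2 * P)"
  proof -
    have "q \<le> P * \<alpha> / 2 / (P * P)"
      unfolding q_def using \<alpha> Rpos r1 D by (intro divide_left_mono) (auto simp: power2_eq_square)
    also have "\<dots> = \<alpha> / (2 * P)" using Rpos by (simp add: field_simps)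
    finally show ?thesis .
  qed
  also have "\<dots> \<le> \<alpha> / (2 * (16 * r))" using Rr r1 \<alpha> by (intro divide_left_mono) auto
  finally have q_le: "q \<le> \<alpha> / (32 * r)" by simp
  have p_ge: "p \<ge> 8 / 17 * (\<alpha> / r)"
  proof -
    have "8 / 17 * (\<alpha> / r) = \<alpha> / 2 / (17 / 16 * r)" by simp
    also have "\<dots> \<le> p" unfolding p_def using r1 \<alpha> by (intro divide_left_mono) auto
    finally show ?thesis .
  qed
  have "p < 1"
  proof -
    have "\<alpha> \<le> r"
    proof (rule ccontr)
      assume "\<not> \<alpha> \<le> r"
      then have "\<alpha> > 1" "r < \<alpha>" using r1 by auto
      moreover then have "\<alpha> * 1 \<le> \<alpha>\<^sup>2" unfolding power2_eq_square by (intro mult_left_mono) auto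
      ultimately show False using \<alpha> by linarith
    qed
    then show ?thesis using r1 by (simp add: p_def field_simps)
  qed
  have pq: "239 / 544 * (\<alpha> / r) \<le> p - q" using p_ge q_le by simp
  have "\<alpha> / r > 0" using \<alpha> r1 by simp
  then have "q \<le> p" using pq by linarith
  have key: "exp (2 * (p - q)) * ((1 - p) * (1 + q)) \<le> (1 + p) * (1 - q)"
    by (rule exp_le_cayley_quotient) fact+
  have Re: "Re (1 / a) = \<alpha> / r" by (simp add: Re_divide \<alpha>_def r power2_eq_square)
  have den: "0 < (norm (of_real (P) + a * (1 / 4)))\<^sup>2" unfolding n4 using D q0 by simp
  have "exp (239 / 272 * Re (1 / a)) * (norm (1 / 4 - a))\<^sup>2 * (norm (of_real (P) + a * (1 / 4)))\<^sup>2
     \<le> exp (2 * (p - q)) * (norm (1 / 4 - a))\<^sup>2 * (norm (of_real (P) + a * (1 / 4)))\<^sup>2"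
    using pq by (intro mult_right_mono) (auto simp: Re)
  also have "\<dots> = (1 / 16 + r) * (P\<^sup>2 + r / 16) * (exp (2 * (p - q)) * ((1 - p) * (1 + q)))"
    unfolding n1 n4 by (simp add: mult_ac)
  also have "\<dots> \<le> (1 / 16 + r) * (P\<^sup>2 + r / 16) * ((1 + p) * (1 - q))"
    using r1 D by (intro mult_left_mono key) auto
  also have "\<dots> = (norm (1 / 4 + cnj a))\<^sup>2 * (norm (of_real (P) - cnj a * (1 / 4)))\<^sup>2"
    unfolding n2 n3 by (simp add: mult_ac)
  finally show ?thesis
    using den by (simp add: reflected_factor_def P_def[symmetric] norm_mult norm_divide power_mult_distrib power_divide
        pos_le_divide_eq del: of_real_power)
qed

section \<open>The density of the zeros\<close>

lemma finite_norm_le: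
  fixes z :: "nat \<Rightarrow> complex"
  assumes "filterlim (\<lambda>j. norm (z j)) at_top sequentially"
  shows "finite {j. norm (z j) \<le> r}"
proof -
  have "eventually (\<lambda>j. r < norm (z j)) sequentially"
    using assms by (simp add: filterlim_at_top_dense)
  then have "finite {j. \<not> r < norm (z j)}"
    by (simp add: eventually_cofinite[symmetric] cofinite_eq_sequentially)
  then show ?thesis by (simp add: not_less)
qed

lemma pi_less_seven_halves: "pi < 7 / 2"
proof (rule ccontr)
  assume "\<not> ?thesis"
  then have "sin (7 / 12) \<le> sin (pi / 6)"
    by (intro sin_monotone_2pi_le) (auto intro: order_trans[of _ 0])
  moreover have "\<bar>sin (7 / 12) - (\<Sum>m<4. sin_coeff m * (7 / 12 :: real) ^ m)\<bar> \<le> inverse (fact 4) * \<bar>7 / 12\<bar> ^ 4"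
    by (rule Maclaurin_sin_bound)
  moreover have "{..<4::nat} = {0, 1, 2, 3}" by auto
  then have "(\<Sum>m<4. sin_coeff m * (7 / 12 :: real) ^ m) = 7 / 12 - (7 / 12) ^ 3 / 6"
    by (simp add: sin_coeff_def fact_numeral)
  ultimately show False
    by (simp add: fact_numeral sin_30 power_divide)
qed

text \<open>
  The point \<open>1/4\<close> lies in the disc \<open>|w| < 1\<close>, which is free of zeros, and is so small that the contribution
  \<open>2 ln (1/|b(1/4)|)\<close> of a zero \<open>a\<close> is nearly \<open>Re (1/a)\<close>, the value of \<open>4 x Re (1/a)\<close> at \<open>x = 1/4\<close>.
  The exponent \<open>1/2\<close> on the right is \<open>2 * (1/4)\<close>, the growth \<open>R powr (2 * Re w)\<close> evaluated there.
\<close>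
lemma half_disc_zero_bound:
  fixes z :: "nat \<Rightarrow> complex"
  assumes U: "open U" "{w. 0 \<le> Re w} \<subseteq> U" and hol: "f holomorphic_on U"
    and axis: "(\<integral>\<^sup>+y. ennreal ((norm (f (Complex 0 y)))\<^sup>2) \<partial>lborel) \<le> ennreal M" "0 \<le> M"
    and growth: "\<And>w. 0 < Re w \<Longrightarrow> norm w = R \<Longrightarrow>
        (norm (f w))\<^sup>2 \<le> K / Re w * exp (K * Re w) * R powr (2 * Re w)" "0 \<le> K"
    and R: "4 \<le> R" and fin: "finite J"
    and z: "\<And>j. j \<in> J \<Longrightarrow> 0 < Re (z j)" "\<And>j. j \<in> J \<Longrightarrow> 1 \<le> norm (z j)" "\<And>j. j \<in> J \<Longrightarrow> 4 * norm (z j) \<le> R"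
    and ev: "\<And>j. j \<in> J \<Longrightarrow> eventually (\<lambda>w. f w \<noteq> 0) (at (z j))"
    and ord: "\<And>j. j \<in> J \<Longrightarrow> int (card {i\<in>J. z i = z j}) \<le> zorder f (z j)"
  shows "(norm (f (1 / 4)))\<^sup>2 * exp (239 / 272 * (\<Sum>j\<in>J. Re (1 / z j))) \<le> (M + K) * exp (K / 4) * R powr (1 / 2)"
proof -
  obtain h where h: "h holomorphic_on U" "\<And>w. w \<in> U \<Longrightarrow> f w = h w * (\<Prod>j\<in>J. w - z j)"
  proof -
    have "z j \<in> U" if "j \<in> J" for j using z(1)[OF that] U(2) by auto
    from factor_out_zeros[OF fin U(1) hol this ev ord] show ?thesis using that by blast
  qed
  define G where "G = (\<lambda>w. h w * (\<Prod>j\<in>J. reflected_factor R (z j) w))"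
  define L where "L = 2 * ln R + K"
  \<comment> \<open>The middle factor tames the corners of the half-disc, the exponential the growth on the arc.\<close>
  define \<Phi> where "\<Phi> = (\<lambda>w. (G w)\<^sup>2 * ((w\<^sup>2 + of_real (R\<^sup>2)) / of_real (R\<^sup>2)) * exp (- of_real L * w))"
  have R0: "R > 0" using R by simp
  have G_eq: "norm (G w) = norm (f w)" if "0 \<le> Re w" "Re w = 0 \<or> norm w = R" for w
  proof -
    have "norm (reflected_factor R (z j) w) = norm (w - z j)" if "j \<in> J" for j
      using norm_reflected_factor_axis[OF z(1)[OF that], of w R]
        norm_reflected_factor_arc[OF z(1)[OF that], of w R] R0 \<open>0 \<le> Re w\<close> \<open>Re w = 0 \<or> norm w = R\<close> by blast
    then show ?thesis
      using h(2)[of w] U(2) \<open>0 \<le> Re w\<close> by (auto simp: G_def norm_mult prod_norm[symmetric] intro!: prod.cong)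
  qed
  have contG: "continuous_on {w. 0 \<le> Re w \<and> norm w \<le> R} \<Phi>" and holG: "\<Phi> holomorphic_on {w. 0 < Re w \<and> norm w < R}"
  proof -
    have nz: "of_real (R\<^sup>2) + z j * w \<noteq> 0" if "j \<in> J" "0 \<le> Re w" for j w
      using reflected_factor_denominator_nonzero[OF z(1)] that R0 by blast
    show "continuous_on {w. 0 \<le> Re w \<and> norm w \<le> R} \<Phi>"
      unfolding \<Phi>_def G_def reflected_factor_def
      by (intro continuous_intros continuous_on_subset[OF holomorphic_on_imp_continuous_on[OF h(1)]])
         (use nz U R0 in auto)
    show "\<Phi> holomorphic_on {w. 0 < Re w \<and> norm w < R}"
      unfolding \<Phi>_def G_def reflected_factor_def
      by (intro holomorphic_intros holomorphic_on_subset[OF h(1)])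
         (use nz U R0 in auto)
  qed
  have main: "2 * pi * norm (\<Phi> (of_real (1 / 4))) \<le> M / (1 / 4) + pi * R * (2 * K / R) / (R - 1 / 4)"
  proof (rule half_disc_Cauchy_bound[OF contG holG])
    have "(\<integral>\<^sup>+y. ennreal (norm (\<Phi> (Complex 0 y))) * indicator {-R..R} y \<partial>lborel)
        \<le> (\<integral>\<^sup>+y. ennreal ((norm (f (Complex 0 y)))\<^sup>2) \<partial>lborel)"
    proof (rule nn_integral_mono)
      fix y :: real
      have "norm (\<Phi> (Complex 0 y)) \<le> (norm (f (Complex 0 y)))\<^sup>2" if "y \<in> {-R..R}"
      proof -
        have "(Complex 0 y)\<^sup>2 + of_real (R\<^sup>2) = of_real (R\<^sup>2 - y\<^sup>2)"
          by (simp add: complex_eq_iff power2_eq_square)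
        moreover have "y\<^sup>2 \<le> R\<^sup>2" using that by (intro abs_le_square_iff[THEN iffD1]) auto
        ultimately have "norm (((Complex 0 y)\<^sup>2 + of_real (R\<^sup>2)) / of_real (R\<^sup>2)) \<le> 1"
          using R0 by (simp add: norm_divide del: of_real_power of_real_diff)
        then have "(norm (f (Complex 0 y)))\<^sup>2 * norm (((Complex 0 y)\<^sup>2 + of_real (R\<^sup>2)) / of_real (R\<^sup>2)) * 1
           \<le> (norm (f (Complex 0 y)))\<^sup>2 * 1 * 1"
          by (intro mult_right_mono mult_left_mono) auto
        moreover have "norm (exp (- of_real L * Complex 0 y)) = 1" by (simp add: norm_exp_eq_Re)
        moreover have "norm (G (Complex 0 y)) = norm (f (Complex 0 y))" by (intro G_eq) auto
        ultimately show ?thesis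
          by (simp only: \<Phi>_def norm_mult norm_power mult_1_right)
      qed
      then show "ennreal (norm (\<Phi> (Complex 0 y))) * indicator {-R..R} y \<le> ennreal ((norm (f (Complex 0 y)))\<^sup>2)"
        by (auto simp: indicator_def intro: ennreal_leI)
    qed
    with axis(1) show "(\<integral>\<^sup>+y. ennreal (norm (\<Phi> (Complex 0 y))) * indicator {-R..R} y \<partial>lborel) \<le> ennreal M"
      by (rule order_trans[rotated])
    fix w :: complex assume w: "0 \<le> Re w" "norm w = R"
    \<comment> \<open>On the arc the middle factor has modulus \<open>2 Re w / R\<close>, which cancels the singularity \<open>K / Re w\<close>.\<close>
    have R2: "of_real (R\<^sup>2) = w * cnj w" using w(2) by (metis complex_norm_square)
    have "w\<^sup>2 + of_real (R\<^sup>2) = w * (w + cnj w)"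
      unfolding R2 by (simp add: power2_eq_square distrib_left)
    then have "w\<^sup>2 + of_real (R\<^sup>2) = w * of_real (2 * Re w)"
      by (simp only: complex_add_cnj)
    then have Q: "norm ((w\<^sup>2 + of_real (R\<^sup>2)) / of_real (R\<^sup>2)) = 2 * Re w / R"
      using w R0 by (simp add: norm_divide norm_mult power2_eq_square)
    have \<Phi>w: "norm (\<Phi> w) = (norm (f w))\<^sup>2 * (2 * Re w / R) * exp (- L * Re w)"
    proof -
      have "norm (exp (- of_real L * w)) = exp (- L * Re w)" by (simp add: norm_exp_eq_Re)
      moreover have "norm (G w) = norm (f w)" using w by (intro G_eq) auto
      ultimately show ?thesis using Q by (simp only: \<Phi>_def norm_mult norm_power)
    qed
    show "norm (\<Phi> w) \<le> 2 * K / R"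
    proof (cases "Re w = 0")
      case True
      then show ?thesis using growth(2) R0 by (simp add: \<Phi>w)
    next
      case False
      then have x: "Re w > 0" using w by simp
      have "norm (\<Phi> w) \<le> (K / Re w * exp (K * Re w) * R powr (2 * Re w)) * (2 * Re w / R) * exp (- L * Re w)"
        unfolding \<Phi>w by (intro mult_right_mono growth(1)) (use x w R0 in auto)
      also have "\<dots> = 2 * K / R * (exp (K * Re w) * exp (2 * Re w * ln R) * exp (- L * Re w))"
        using x R0 by (simp add: powr_def field_simps)
      also have "exp (K * Re w) * exp (2 * Re w * ln R) * exp (- L * Re w) = 1"
        by (simp add: exp_add[symmetric] L_def algebra_simps)
      finally show ?thesis by simp
    qed
  qed (use R growth axis in auto)
  have "pi * R * (2 * K / R) / (R - 1 / 4) \<le> 2 * pi * K"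
    using R growth(2) mult_left_mono[of 1 "R - 1 / 4" "2 * pi * K"] by (simp add: pos_divide_le_eq)
  moreover have "4 * M \<le> 2 * pi * M" using pi_ge_two axis(2) by (intro mult_right_mono) auto
  ultimately have "2 * pi * norm (\<Phi> (of_real (1 / 4))) \<le> 2 * pi * (M + K)"
    using main by (simp add: algebra_simps)
  then have main': "norm (\<Phi> (1 / 4)) \<le> M + K" by simp
  have prod_ge: "(norm (f (1 / 4)))\<^sup>2 * exp (239 / 272 * (\<Sum>j\<in>J. Re (1 / z j))) \<le> (norm (G (1 / 4)))\<^sup>2"
  proof -
    have "(norm (f (1 / 4)))\<^sup>2 * exp (239 / 272 * (\<Sum>j\<in>J. Re (1 / z j)))
       = (norm (h (1 / 4)))\<^sup>2 * (\<Prod>j\<in>J. exp (239 / 272 * Re (1 / z j)) * (norm (1 / 4 - z j))\<^sup>2)"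
    proof -
      have "norm (f (1 / 4)) = norm (h (1 / 4)) * (\<Prod>j\<in>J. norm (1 / 4 - z j))"
      proof -
        have "1 / 4 \<in> {w. 0 \<le> Re w}" by simp
        then have "f (1 / 4) = h (1 / 4) * (\<Prod>j\<in>J. 1 / 4 - z j)" using U(2) h(2) by blast
        then show ?thesis by (simp only: norm_mult prod_norm)
      qed
      moreover have "exp (239 / 272 * (\<Sum>j\<in>J. Re (1 / z j))) = (\<Prod>j\<in>J. exp (239 / 272 * Re (1 / z j)))"
        by (simp only: sum_distrib_left exp_sum[OF fin])
      ultimately show ?thesis
        by (simp only: power_mult_distrib prod_power_distrib prod.distrib mult_ac)
    qed
    also have "\<dots> \<le> (norm (h (1 / 4)))\<^sup>2 * (\<Prod>j\<in>J. (norm (reflected_factor R (z j) (1 / 4)))\<^sup>2)"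
      by (intro mult_left_mono prod_mono conjI norm_reflected_factor_ge z) auto
    also have "\<dots> = (norm (G (1 / 4)))\<^sup>2"
      by (simp only: G_def norm_mult power_mult_distrib prod_power_distrib prod_norm[symmetric])
    finally show ?thesis .
  qed
  have "(norm (G (1 / 4)))\<^sup>2 * 1 * exp (- L / 4) \<le> (norm (G (1 / 4)))\<^sup>2 * norm (((1 / 4)\<^sup>2 + of_real (R\<^sup>2)) / of_real (R\<^sup>2) :: complex) * exp (- L / 4)"
  proof (intro mult_right_mono mult_left_mono)
    have "((1 / 4)\<^sup>2 + of_real (R\<^sup>2)) / of_real (R\<^sup>2) = (of_real (((1 / 4)\<^sup>2 + R\<^sup>2) / R\<^sup>2) :: complex)" by simp
    then have "norm (((1 / 4)\<^sup>2 + of_real (R\<^sup>2)) / of_real (R\<^sup>2) :: complex) = ((1 / 4)\<^sup>2 + R\<^sup>2) / R\<^sup>2"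
      by (simp only: norm_of_real) simp
    also have "\<dots> \<ge> 1" using R0 by (simp add: pos_le_divide_eq)
    finally show "1 \<le> norm (((1 / 4)\<^sup>2 + of_real (R\<^sup>2)) / of_real (R\<^sup>2) :: complex)" .
  qed auto
  also have "\<dots> = norm (\<Phi> (1 / 4))"
  proof -
    have "norm (exp (- of_real L * (1 / 4) :: complex)) = exp (- L / 4)" by (simp add: norm_exp_eq_Re)
    then show ?thesis by (simp only: \<Phi>_def norm_mult norm_power)
  qed
  also have "\<dots> \<le> M + K" by (rule main')
  finally have "(norm (G (1 / 4)))\<^sup>2 * exp (- L / 4) \<le> M + K" by simp
  then have "(norm (G (1 / 4)))\<^sup>2 * exp (- L / 4) * exp (L / 4) \<le> (M + K) * exp (L / 4)"
    by (intro mult_right_mono) auto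
  then have "(norm (G (1 / 4)))\<^sup>2 \<le> (M + K) * exp (L / 4)"
    by (simp add: mult.assoc exp_add[symmetric])
  also have "exp (L / 4) = exp (K / 4) * R powr (1 / 2)"
    using R0 by (simp add: L_def powr_def exp_add[symmetric] add_divide_distrib)
  finally show ?thesis using prod_ge by (simp add: mult.assoc)
qed

text \<open>
  The inequality on the half-disc of radius \<open>4\<rho>\<close> controls the zeros of modulus at most \<open>\<rho>\<close>; the factor 4
  costs only a constant after taking logarithms.
\<close>
lemma zero_set_necessary_condition:
  fixes z :: "nat \<Rightarrow> complex"
  assumes zR: "\<forall>j. z j \<in> right_half_plane" and z1: "\<forall>j. 1 \<le> norm (z j)"
    and lim: "filterlim (\<lambda>j. norm (z j)) at_top sequentially"
    and zs: "is_zero_set (M2_omega \<inter> Hol_closed_half_plane) z"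
  shows "Limsup at_top (\<lambda>R. ereal (1 / ln R * (\<Sum>j\<in>{j. norm (z j) \<le> R}. Re (1 / z j)))) \<le> ereal (2 / pi)"
proof -
  obtain f where f: "f \<in> M2_omega" "f analytic_on {w. 0 \<le> Re w}"
    and zeros: "{w. 0 \<le> Re w \<and> f w = 0} = range z"
    and ord: "\<And>w. w \<in> range z \<Longrightarrow> zorder f w = int (card {j. z j = w})"
    using zs by (auto simp: is_zero_set_def Hol_closed_half_plane_def closure_right_half_plane)
  obtain U where U: "open U" "{w. 0 \<le> Re w} \<subseteq> U" "f holomorphic_on U"
    using f(2) by (auto simp: analytic_on_holomorphic)
  have cont: "continuous_on {w. 0 \<le> Re w} f"
    using U holomorphic_on_imp_continuous_on holomorphic_on_subset by blast
  have Rez: "0 < Re (z j)" for j using zR by (simp add: right_half_plane_def)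
  have ev: "eventually (\<lambda>w. f w \<noteq> 0) (at (z j))" for j
  proof -
    define F where "F = z ` {i. norm (z i) \<le> norm (z j) + 1}"
    have "finite F" unfolding F_def by (intro finite_imageI finite_norm_le lim)
    then have "eventually (\<lambda>w. w \<notin> F) (at (z j))"
      using islimpt_finite[of F "z j"] by (simp add: islimpt_iff_eventually)
    moreover have "eventually (\<lambda>w. w \<in> ball (z j) 1) (at (z j))"
      by (intro eventually_at_in_open') auto
    moreover have "eventually (\<lambda>w. w \<in> {w. 0 < Re w}) (at (z j))"
      by (intro eventually_at_in_open' open_Collect_less continuous_intros) (use Rez in auto)
    ultimately show ?thesis
    proof eventually_elim
      case (elim w)
      have "norm w \<le> norm (z j) + 1"
        using elim(2) norm_triangle_ineq2[of w "z j"] by (simp add: dist_norm norm_minus_commute)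
      then have "w \<notin> range z" using elim(1) by (auto simp: F_def)
      then show ?case using zeros elim(3) by auto
    qed
  qed
  obtain M where M: "M \<ge> 0" "(\<integral>\<^sup>+y. ennreal ((norm (f (Complex 0 y)))\<^sup>2) \<partial>lborel) \<le> ennreal M"
    using H2_strip_slices_bounded[of f 1] cont f(1) by (auto simp: M2_omega_def)
  obtain K where K: "K \<ge> 0" "\<And>R w. 0 < Re w \<Longrightarrow> Re w \<le> R \<Longrightarrow> 1 \<le> R \<Longrightarrow>
           (norm (f w))\<^sup>2 \<le> K / Re w * exp (K * Re w) * R powr (2 * Re w)"
    using M2_omega_growth[OF f(1) cont] by auto
  define S where "S = (\<lambda>\<rho>. \<Sum>j\<in>{j. norm (z j) \<le> \<rho>}. Re (1 / z j))"
  have bound: "(norm (f (1 / 4)))\<^sup>2 * exp (239 / 272 * S \<rho>) \<le> (M + K) * exp (K / 4) * (4 * \<rho>) powr (1 / 2)"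
    if "\<rho> \<ge> 1" for \<rho>
    unfolding S_def
  proof (rule half_disc_zero_bound[OF U(1,2,3) M(2,1) _ K(1)])
    show "(norm (f w))\<^sup>2 \<le> K / Re w * exp (K * Re w) * (4 * \<rho>) powr (2 * Re w)"
      if "0 < Re w" "norm w = 4 * \<rho>" for w
      using K(2)[of w "4 * \<rho>"] that \<open>\<rho> \<ge> 1\<close> complex_Re_le_cmod[of w] by auto
    show "int (card {i \<in> {j. norm (z j) \<le> \<rho>}. z i = z j}) \<le> zorder f (z j)"
      if "j \<in> {j. norm (z j) \<le> \<rho>}" for j
    proof -
      have "{i \<in> {j. norm (z j) \<le> \<rho>}. z i = z j} = {i. z i = z j}" using that by auto
      then show ?thesis using ord[of "z j"] by simp
    qed
  qed (use that z1 Rez ev finite_norm_le[OF lim] in auto)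
  have "norm (1 / 4 :: complex) < 1" by simp
  then have "1 / 4 \<notin> range z" using z1 by (metis imageE not_le)
  then have f0: "(norm (f (1 / 4)))\<^sup>2 > 0"
    using zeros by auto
  define C where "C = (M + K) * exp (K / 4) * 2 / (norm (f (1 / 4)))\<^sup>2"
  have bound': "exp (239 / 272 * S \<rho>) \<le> C * \<rho> powr (1 / 2)" if "\<rho> \<ge> 1" for \<rho>
  proof -
    have "exp (239 / 272 * S \<rho>) \<le> (M + K) * exp (K / 4) * (4 * \<rho>) powr (1 / 2) / (norm (f (1 / 4)))\<^sup>2"
      using bound[OF that] f0 by (simp add: pos_le_divide_eq mult.commute)
    also have "(4 * \<rho>) powr (1 / 2) = 2 * \<rho> powr (1 / 2)"
      using that by (simp add: powr_mult powr_half_sqrt)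
    finally show ?thesis by (simp add: C_def mult_ac)
  qed
  have Cpos: "C > 0"
    using bound'[of 1] by (auto intro: order.strict_trans2[OF exp_gt_zero])
  have bound'': "S \<rho> \<le> 136 / 239 * ln \<rho> + 272 / 239 * ln C" if "\<rho> \<ge> 1" for \<rho>
  proof -
    have "239 / 272 * S \<rho> = ln (exp (239 / 272 * S \<rho>))" by simp
    also have "\<dots> \<le> ln (C * \<rho> powr (1 / 2))" using bound'[OF that] by (subst ln_le_cancel_iff) (use Cpos that in auto)
    also have "\<dots> = ln C + ln \<rho> / 2" using Cpos that by (simp add: ln_mult ln_powr)
    finally show ?thesis by simp
  qed
  have "4 / 7 < 2 / pi" using pi_less_seven_halves pi_gt_zero by (simp add: field_simps)
  have "((\<lambda>\<rho>. 136 / 239 + 272 / 239 * ln C / ln \<rho>) \<longlongrightarrow> 136 / 239 + 0) at_top"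
    by (intro tendsto_add tendsto_const tendsto_divide_0[OF tendsto_const] filterlim_at_top_imp_at_infinity ln_at_top)
  moreover have "136 / 239 + 0 < (2 / pi :: real)" using \<open>4 / 7 < 2 / pi\<close> by simp
  ultimately have "eventually (\<lambda>\<rho>. 136 / 239 + 272 / 239 * ln C / ln \<rho> < 2 / pi) at_top"
    by (rule order_tendstoD)
  then have "eventually (\<lambda>\<rho>. ereal (1 / ln \<rho> * S \<rho>) \<le> ereal (2 / pi)) at_top"
    using eventually_gt_at_top[of 1]
  proof eventually_elim
    case (elim \<rho>)
    have "1 / ln \<rho> * S \<rho> \<le> 1 / ln \<rho> * (136 / 239 * ln \<rho> + 272 / 239 * ln C)"
      using elim bound''[of \<rho>] by (intro mult_left_mono) auto
    also have "\<dots> = 136 / 239 + 272 / 239 * ln C / ln \<rho>" using elim by (simp add: field_simps)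
    finally show ?case using elim by simp
  qed
  then show ?thesis unfolding S_def by (rule Limsup_bounded)
qed

section \<open>An even canonical product of small exponential type\<close>

text \<open>
  Writing \<open>ln (1 + r\<^sup>2/t\<^sup>2)\<close> as an integral over \<open>s \<ge> t\<close> turns a sum over points into an integral
  against their counting function.
\<close>
lemma nn_integral_log_kernel:
  fixes r t :: real
  assumes "0 < t"
  shows "(\<integral>\<^sup>+s. ennreal (2 * r\<^sup>2 / (s * (s\<^sup>2 + r\<^sup>2))) * indicator {t..} s \<partial>lborel) = ennreal (ln (1 + r\<^sup>2 / t\<^sup>2))"
proof -
  have "(\<integral>\<^sup>+s. ennreal (2 * r\<^sup>2 / (s * (s\<^sup>2 + r\<^sup>2))) * indicator {t..} s \<partial>lborel) = ennreal (0 - (- ln (1 + r\<^sup>2 / t\<^sup>2)))"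
  proof (rule nn_integral_FTC_atLeast)
    fix s assume s: "t \<le> s"
    then have "s > 0" using assms by simp
    have pos: "1 + r\<^sup>2 / s\<^sup>2 > 0" by (simp add: add_pos_nonneg)
    have nz: "s\<^sup>2 + r\<^sup>2 > 0" using \<open>s > 0\<close> by (simp add: add_pos_nonneg)
    have "((\<lambda>s. - ln (1 + r\<^sup>2 / s\<^sup>2)) has_real_derivative - ((- (r\<^sup>2 * (2 * s)) / (s\<^sup>2 * s\<^sup>2)) / (1 + r\<^sup>2 / s\<^sup>2))) (at s)"
      using \<open>s > 0\<close> pos by (auto intro!: derivative_eq_intros)
    also have "- ((- (r\<^sup>2 * (2 * s)) / (s\<^sup>2 * s\<^sup>2)) / (1 + r\<^sup>2 / s\<^sup>2)) = 2 * r\<^sup>2 / (s * (s\<^sup>2 + r\<^sup>2))"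
    proof -
      have "1 + r\<^sup>2 / s\<^sup>2 = (s\<^sup>2 + r\<^sup>2) / s\<^sup>2" using \<open>s > 0\<close> by (simp add: field_simps)
      then show ?thesis using \<open>s > 0\<close> nz by (simp add: power2_eq_square)
    qed
    finally show "((\<lambda>s. - ln (1 + r\<^sup>2 / s\<^sup>2)) has_real_derivative 2 * r\<^sup>2 / (s * (s\<^sup>2 + r\<^sup>2))) (at s)" .
    show "0 \<le> 2 * r\<^sup>2 / (s * (s\<^sup>2 + r\<^sup>2))" using \<open>s > 0\<close> by simp
  next
    have "((\<lambda>s::real. r\<^sup>2 / s\<^sup>2) \<longlongrightarrow> 0) at_top"
      by (intro tendsto_divide_0[OF tendsto_const] filterlim_at_top_imp_at_infinity
            filterlim_pow_at_top filterlim_ident) auto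
    then have "((\<lambda>s::real. - ln (1 + r\<^sup>2 / s\<^sup>2)) \<longlongrightarrow> - ln (1 + 0)) at_top"
      by (intro tendsto_intros) auto
    then show "((\<lambda>s::real. - ln (1 + r\<^sup>2 / s\<^sup>2)) \<longlongrightarrow> 0) at_top" by simp
  qed measurable
  then show ?thesis by simp
qed

lemma nn_integral_arctan_kernel_le:
  fixes r :: real
  assumes "0 < r"
  shows "(\<integral>\<^sup>+s. ennreal (2 * r\<^sup>2 / (s\<^sup>2 + r\<^sup>2)) * indicator {1..} s \<partial>lborel) \<le> ennreal (pi * r)"
proof -
  have "(\<integral>\<^sup>+s. ennreal (2 * r\<^sup>2 / (s\<^sup>2 + r\<^sup>2)) * indicator {1..} s \<partial>lborel) = ennreal (2 * r * (pi / 2) - 2 * r * arctan (1 / r))"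
  proof (rule nn_integral_FTC_atLeast)
    fix s :: real assume "1 \<le> s"
    have nz: "s\<^sup>2 + r\<^sup>2 > 0" using assms by (simp add: add_nonneg_pos)
    have "((\<lambda>s. 2 * r * arctan (s / r)) has_real_derivative 2 * r * (inverse (1 + (s / r)\<^sup>2) * (1 / r))) (at s)"
      using assms by (auto intro!: derivative_eq_intros)
    also have "2 * r * (inverse (1 + (s / r)\<^sup>2) * (1 / r)) = 2 * r\<^sup>2 / (s\<^sup>2 + r\<^sup>2)"
    proof -
      have "1 + (s / r)\<^sup>2 = (s\<^sup>2 + r\<^sup>2) / r\<^sup>2" using assms by (simp add: field_simps)
      then show ?thesis using assms nz by (simp add: power2_eq_square)
    qed
    finally show "((\<lambda>s. 2 * r * arctan (s / r)) has_real_derivative 2 * r\<^sup>2 / (s\<^sup>2 + r\<^sup>2)) (at s)" .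
    show "0 \<le> 2 * r\<^sup>2 / (s\<^sup>2 + r\<^sup>2)" using nz by simp
  next
    have "filterlim (\<lambda>s::real. s / r) at_top at_top"
      using filterlim_tendsto_pos_mult_at_top[OF tendsto_const[of "1 / r"] _ filterlim_ident] assms by simp
    then have "((\<lambda>s::real. arctan (s / r)) \<longlongrightarrow> pi / 2) at_top"
      by (rule filterlim_compose[OF tendsto_arctan_at_top])
    then show "((\<lambda>s::real. 2 * r * arctan (s / r)) \<longlongrightarrow> 2 * r * (pi / 2)) at_top"
      by (intro tendsto_intros)
  qed measurable
  also have "\<dots> \<le> ennreal (pi * r)"
    using assms by (intro ennreal_leI) (simp add: zero_le_arctan_iff)
  finally show ?thesis .
qed

text \<open>
  Exchanging sum and integral in the representation of \<open>ln (1 + r\<^sup>2/t\<^sup>2)\<close> leaves the counting function,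
  whose constant part \<open>N\<close> integrates to a logarithm and whose linear part \<open>d s\<close> to at most \<open>\<pi> d r\<close>.
\<close>
lemma sum_ln_le_of_counting_bound:
  fixes t :: "nat \<Rightarrow> real"
  assumes fin: "finite J" and t: "\<And>j. j \<in> J \<Longrightarrow> 1 \<le> t j"
    and count: "\<And>s. 1 \<le> s \<Longrightarrow> real (card {j\<in>J. t j \<le> s}) \<le> N + d * s"
    and "0 \<le> N" "0 \<le> d" "0 < r"
  shows "(\<Sum>j\<in>J. ln (1 + r\<^sup>2 / (t j)\<^sup>2)) \<le> N * ln (1 + r\<^sup>2) + d * (pi * r)"
proof -
  let ?k = "\<lambda>s::real. 2 * r\<^sup>2 / (s * (s\<^sup>2 + r\<^sup>2))"
  have ln_nonneg: "0 \<le> ln (1 + r\<^sup>2 / u\<^sup>2)" for u :: real by (intro ln_ge_zero) auto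
  have "ennreal (\<Sum>j\<in>J. ln (1 + r\<^sup>2 / (t j)\<^sup>2)) = (\<Sum>j\<in>J. ennreal (ln (1 + r\<^sup>2 / (t j)\<^sup>2)))"
    using ln_nonneg by (intro sum_ennreal[symmetric]) auto
  also have "\<dots> = (\<Sum>j\<in>J. \<integral>\<^sup>+s. ennreal (?k s) * indicator {t j..} s \<partial>lborel)"
  proof (intro sum.cong refl)
    fix j assume "j \<in> J"
    then have "0 < t j" using t by fastforce
    then show "ennreal (ln (1 + r\<^sup>2 / (t j)\<^sup>2)) = (\<integral>\<^sup>+s. ennreal (?k s) * indicator {t j..} s \<partial>lborel)"
      by (rule nn_integral_log_kernel[symmetric])
  qed
  also have "\<dots> = (\<integral>\<^sup>+s. (\<Sum>j\<in>J. ennreal (?k s) * indicator {t j..} s) \<partial>lborel)"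
    by (rule nn_integral_sum[symmetric]) measurable
  also have "\<dots> \<le> (\<integral>\<^sup>+s. ennreal N * (ennreal (?k s) * indicator {1..} s)
                    + ennreal d * (ennreal (2 * r\<^sup>2 / (s\<^sup>2 + r\<^sup>2)) * indicator {1..} s) \<partial>lborel)"
  proof (rule nn_integral_mono)
    fix s :: real
    show "(\<Sum>j\<in>J. ennreal (?k s) * indicator {t j..} s) \<le> ennreal N * (ennreal (?k s) * indicator {1..} s)
                    + ennreal d * (ennreal (2 * r\<^sup>2 / (s\<^sup>2 + r\<^sup>2)) * indicator {1..} s)"
    proof (cases "1 \<le> s")
      case True
      have k0: "0 \<le> ?k s" using True by simp
      have "(\<Sum>j\<in>J. ennreal (?k s) * indicator {t j..} s) = (\<Sum>j\<in>{j\<in>J. t j \<le> s}. ennreal (?k s))"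
        by (intro sum.mono_neutral_cong_right fin) (auto simp: indicator_def)
      also have "\<dots> = ennreal (real (card {j\<in>J. t j \<le> s}) * ?k s)"
        using k0 by (simp only: sum_constant ennreal_of_nat_eq_real_of_nat ennreal_mult of_nat_0_le_iff)
      also have "\<dots> \<le> ennreal ((N + d * s) * ?k s)"
        using count[OF True] k0 by (intro ennreal_leI mult_right_mono)
      also have "(N + d * s) * ?k s = N * ?k s + d * (2 * r\<^sup>2 / (s\<^sup>2 + r\<^sup>2))"
        proof -
          have "s * ?k s = 2 * r\<^sup>2 / (s\<^sup>2 + r\<^sup>2)" using True by simp
          then show ?thesis by (simp only: distrib_right mult.assoc)
        qed
      also have "ennreal \<dots> = ennreal N * ennreal (?k s) + ennreal d * ennreal (2 * r\<^sup>2 / (s\<^sup>2 + r\<^sup>2))"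
      proof -
        have "ennreal (N * ?k s) = ennreal N * ennreal (?k s)"
          "ennreal (d * (2 * r\<^sup>2 / (s\<^sup>2 + r\<^sup>2))) = ennreal d * ennreal (2 * r\<^sup>2 / (s\<^sup>2 + r\<^sup>2))"
          using \<open>0 \<le> N\<close> \<open>0 \<le> d\<close> k0 by (intro ennreal_mult; simp)+
        moreover have "0 \<le> N * ?k s" "0 \<le> d * (2 * r\<^sup>2 / (s\<^sup>2 + r\<^sup>2))"
          using \<open>0 \<le> N\<close> \<open>0 \<le> d\<close> k0 by (intro mult_nonneg_nonneg; simp)+
        ultimately show ?thesis by (simp only: ennreal_plus)
      qed
      finally show ?thesis using True by simp
    next
      case False
      then have "indicator {t j..} s = (0::ennreal)" if "j \<in> J" for j
        using t[OF that] by (auto simp: indicator_def)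
      then show ?thesis by simp
    qed
  qed
  also have "\<dots> = ennreal N * (\<integral>\<^sup>+s. ennreal (?k s) * indicator {1..} s \<partial>lborel)
                 + ennreal d * (\<integral>\<^sup>+s. ennreal (2 * r\<^sup>2 / (s\<^sup>2 + r\<^sup>2)) * indicator {1..} s \<partial>lborel)"
    by (subst nn_integral_add) (auto simp: nn_integral_cmult)
  also have "\<dots> \<le> ennreal N * ennreal (ln (1 + r\<^sup>2)) + ennreal d * ennreal (pi * r)"
    using nn_integral_log_kernel[of 1 r] nn_integral_arctan_kernel_le[OF \<open>0 < r\<close>]
    by (intro add_mono mult_left_mono) auto
  also have "\<dots> = ennreal (N * ln (1 + r\<^sup>2) + d * (pi * r))"
    using assms(4-6) ln_nonneg[of 1] by (subst ennreal_plus) (auto simp: ennreal_mult)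
  finally show ?thesis
    using assms(4-6) ln_nonneg[of 1] by (subst (asm) ennreal_le_iff) auto
qed

text \<open>
  The tangent of the logarithm at \<open>1/\<delta>\<close>: any slope \<open>\<delta>\<close>, however small, is enough up to an additive constant.
\<close>
lemma ln_one_plus_le:
  fixes t \<delta> :: real
  assumes "0 \<le> t" "0 < \<delta>"
  shows "ln (1 + t) \<le> \<delta> * t + (\<delta> - 1 - ln \<delta>)"
proof -
  have "ln (1 + t) + ln \<delta> = ln (\<delta> * (1 + t))" using assms by (simp add: ln_mult)
  also have "\<dots> \<le> \<delta> * (1 + t) - 1" using assms by (intro ln_le_minus_one) auto
  finally show ?thesis by (simp add: algebra_simps)
qed

lemma ln_one_plus_square_le:
  fixes t :: real
  assumes "0 \<le> t"
  shows "ln (1 + t\<^sup>2) \<le> 2 * ln (1 + t)"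
proof -
  have "ln (1 + t\<^sup>2) \<le> ln ((1 + t)\<^sup>2)"
    using assms by (subst ln_le_cancel_iff) (auto simp: power2_sum add_pos_nonneg)
  also have "\<dots> = 2 * ln (1 + t)" using assms by (simp add: ln_realpow)
  finally show ?thesis .
qed

text \<open>
  The Weierstrass product of genus 0 with zeros \<open>z\<^sub>j\<^sup>2\<close>, composed with the square.  In the closed right
  half-plane \<open>z\<^sub>j\<^sup>2 = w\<^sup>2\<close> forces \<open>z\<^sub>j = w\<close>, and away from 0 the square is locally injective, so
  multiplicities are preserved.
\<close>
lemma even_canonical_product_exists:
  fixes z :: "nat \<Rightarrow> complex"
  assumes zR: "\<And>j. 0 < Re (z j)" and z1: "\<And>j. 1 \<le> norm (z j)"
    and lim: "filterlim (\<lambda>j. norm (z j)) at_top sequentially"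
    and summ: "summable (\<lambda>j. 1 / (norm (z j))\<^sup>2)"
    and count: "\<And>s. 1 \<le> s \<Longrightarrow> real (counting z s) \<le> N + d * s" "0 \<le> N" "0 \<le> d"
  obtains P where "P holomorphic_on UNIV" "\<And>w. 0 \<le> Re w \<Longrightarrow> P w = 0 \<longleftrightarrow> w \<in> range z"
    "\<And>w. w \<in> range z \<Longrightarrow> zorder P w = int (card {j. z j = w})"
    "\<And>w. w \<noteq> 0 \<Longrightarrow> norm (P w) \<le> exp (N * ln (1 + (norm w)\<^sup>2) + d * (pi * norm w))"
proof -
  define a where "a = (\<lambda>j. (z j)\<^sup>2)"
  interpret W: weierstrass_product a "\<lambda>_. 0"
  proof
    show "a n \<noteq> 0" for n using zR[of n] by (auto simp: a_def)
    have "filterlim (\<lambda>j. norm (z j) ^ 2) at_top sequentially"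
      by (intro filterlim_pow_at_top lim) auto
    then show "filterlim a at_infinity sequentially"
      by (intro filterlim_norm_at_top_imp_at_infinity) (simp add: a_def norm_power)
    show "summable (\<lambda>n. (r / norm (a n)) ^ Suc 0)" if "r > 0" for r
      using summable_mult[OF summ, of r] by (simp add: a_def norm_power)
  qed
  define P where "P = (\<lambda>w. W.f (w\<^sup>2))"
  have sq_eq: "(z j)\<^sup>2 = w\<^sup>2 \<longleftrightarrow> z j = w" if "0 \<le> Re w" for j w
    using zR[of j] that by (auto simp: power2_eq_iff)
  have vimage: "a -` {w\<^sup>2} = {j. z j = w}" if "0 \<le> Re w" for w
    using sq_eq[OF that] by (auto simp: a_def)
  show ?thesis
  proof (rule that[of P])
    have "W.f \<circ> (\<lambda>w. w\<^sup>2) holomorphic_on UNIV"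
      by (intro holomorphic_on_compose_gen[of _ _ _ UNIV] W.holomorphic holomorphic_intros) auto
    then show "P holomorphic_on UNIV" by (simp add: P_def o_def)
  next
    fix w :: complex assume "0 \<le> Re w"
    then show "P w = 0 \<longleftrightarrow> w \<in> range z"
      unfolding P_def W.zero using sq_eq[of w] by (metis (mono_tags) a_def image_iff)
  next
    fix w assume "w \<in> range z"
    then have w: "0 < Re w" using zR by auto
    then have "w \<noteq> 0" by auto
    have "zorder P w = zorder (W.f \<circ> (\<lambda>w. w\<^sup>2)) w" by (simp add: P_def o_def)
    also have "\<dots> = zorder W.f (w\<^sup>2) * zorder (\<lambda>x. x\<^sup>2 - w\<^sup>2) w"
    proof (rule zorder_compose')
      show "isolated_singularity_at W.f (w\<^sup>2)" "not_essential W.f (w\<^sup>2)"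
        using W.analytic[of "{w\<^sup>2}"] isolated_singularity_at_analytic not_essential_analytic by auto
      show "eventually (\<lambda>x. W.f x \<noteq> 0) (at (w\<^sup>2))"
        using W.not_islimpt_range_a[of "w\<^sup>2"] by (simp add: islimpt_iff_eventually W.zero)
      have "eventually (\<lambda>x. x \<noteq> - w) (at w)"
        using \<open>w \<noteq> 0\<close> by (intro eventually_neq_at_within) 
      then show "eventually (\<lambda>x. x\<^sup>2 \<noteq> w\<^sup>2) (at w)"
        using eventually_neq_at_within[of w w UNIV]
        by eventually_elim (auto simp: power2_eq_iff)
    qed (auto intro!: analytic_intros)
    also have "zorder (\<lambda>x. x\<^sup>2 - w\<^sup>2) w = 1"
      by (rule zorder_eqI[of UNIV _ "\<lambda>x. x + w"])
         (use \<open>w \<noteq> 0\<close> in \<open>auto intro!: holomorphic_intros simp: power2_eq_square algebra_simps\<close>)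
    also have "zorder W.f (w\<^sup>2) = int (card {j. z j = w})"
      using W.zorder[of "w\<^sup>2"] vimage[of w] w by simp
    finally show "zorder P w = int (card {j. z j = w})" by simp
  next
    fix w :: complex assume w: "w \<noteq> 0"
    let ?r = "norm w"
    have "(\<lambda>n. \<Prod>k\<le>n. 1 - w\<^sup>2 / a k) \<longlonglongrightarrow> P w"
      using has_prod_imp_tendsto[OF W.has_prod[of "w\<^sup>2"]] by (simp add: weierstrass_factor_def P_def)
    then have "(\<lambda>n. norm (\<Prod>k\<le>n. 1 - w\<^sup>2 / a k)) \<longlonglongrightarrow> norm (P w)" by (rule tendsto_norm)
    then show "norm (P w) \<le> exp (N * ln (1 + ?r\<^sup>2) + d * (pi * ?r))"
    proof (rule LIMSEQ_le_const2, intro exI allI impI)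
      fix n :: nat
      have "norm (\<Prod>k\<le>n. 1 - w\<^sup>2 / a k) = (\<Prod>k\<le>n. norm (1 - w\<^sup>2 / a k))" by (rule prod_norm[symmetric])
      also have "\<dots> \<le> (\<Prod>k\<le>n. 1 + ?r\<^sup>2 / (norm (z k))\<^sup>2)"
      proof (intro prod_mono conjI)
        fix k
        show "norm (1 - w\<^sup>2 / a k) \<le> 1 + ?r\<^sup>2 / (norm (z k))\<^sup>2"
          using norm_triangle_ineq4[of 1 "w\<^sup>2 / a k"] by (simp add: a_def norm_divide norm_power)
      qed auto
      also have "\<dots> = exp (\<Sum>k\<le>n. ln (1 + ?r\<^sup>2 / (norm (z k))\<^sup>2))"
        by (subst exp_sum) (auto intro!: prod.cong simp: add_pos_nonneg)
      also have "\<dots> \<le> exp (N * ln (1 + ?r\<^sup>2) + d * (pi * ?r))"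
      proof (subst exp_le_cancel_iff, rule sum_ln_le_of_counting_bound)
        fix s :: real assume s: "1 \<le> s"
        have "card {j \<in> {..n}. norm (z j) \<le> s} \<le> counting z s"
          unfolding counting_def by (intro card_mono finite_norm_le lim) auto
        then show "real (card {j \<in> {..n}. norm (z j) \<le> s}) \<le> N + d * s"
          using count(1)[OF s] by linarith
      qed (use z1 count w in auto)
      finally show "norm (\<Prod>k\<le>n. 1 - w\<^sup>2 / a k) \<le> exp (N * ln (1 + ?r\<^sup>2) + d * (pi * ?r))" .
    qed
  qed
qed

section \<open>Membership of the constructed function\<close>

lemma arctan_le_self:
  fixes t :: real
  assumes "0 \<le> t"
  shows "arctan t \<le> t"
proof -
  have "0 - arctan 0 \<le> t - arctan t"
  proof (rule DERIV_nonneg_imp_nondecreasing[OF assms])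
    fix x :: real
    have "((\<lambda>x. x - arctan x) has_real_derivative 1 - inverse (1 + x\<^sup>2)) (at x)"
      by (auto intro!: derivative_eq_intros)
    moreover have "inverse (1 + x\<^sup>2) \<le> 1" by (intro inverse_le_1_iff[THEN iffD2]) auto
    ultimately show "\<exists>y. ((\<lambda>x. x - arctan x) has_real_derivative y) (at x) \<and> 0 \<le> y" by force
  qed
  then show ?thesis by simp
qed

lemma mult_arctan_quotient_ge:
  fixes y u :: real
  assumes "0 < u"
  shows "pi / 2 * \<bar>y\<bar> - u \<le> y * arctan (y / u)"
proof (cases "y = 0")
  case False
  define t where "t = \<bar>y\<bar> / u"
  have t: "t > 0" using False assms by (simp add: t_def)
  have "y * arctan (y / u) = \<bar>y\<bar> * arctan t"
    by (cases "y \<ge> 0") (auto simp: t_def arctan_minus)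
  moreover have "arctan t = pi / 2 - arctan (1 / t)"
  proof -
    have "arctan (inverse t) = pi / 2 - arctan t" using t by (rule arctan_inverse)
    then show ?thesis by (simp add: inverse_eq_divide)
  qed
  moreover have "arctan (1 / t) \<le> u / \<bar>y\<bar>" using arctan_le_self[of "1 / t"] t assms by (simp add: t_def)
  then have "\<bar>y\<bar> * (pi / 2 - arctan (1 / t)) \<ge> \<bar>y\<bar> * (pi / 2 - u / \<bar>y\<bar>)"
    by (intro mult_left_mono) auto
  ultimately show ?thesis using False by (simp add: algebra_simps)
qed (use assms in simp)

text \<open>
  The real part is \<open>x ln |w + 1| - y arg (w + 1)\<close>.  The argument tends to \<open>\<plusminus>\<pi>/2\<close> with an error of order
  \<open>(x + 1)/|y|\<close>, which costs \<open>x + 1\<close>, and the excess of \<open>ln |w + 1|\<close> over \<open>ln (x + 1)\<close> is logarithmic in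
  \<open>|y|/(x + 1)\<close>, which costs an arbitrarily small multiple of \<open>|y|\<close>.
\<close>
lemma Re_mult_Ln_plus_one_le:
  fixes w :: complex and \<delta> :: real
  assumes "0 \<le> Re w" "0 < \<delta>"
  shows "Re (w * Ln (w + 1)) \<le> Re w * ln (Re w + 1) - (pi / 2 - \<delta>) * \<bar>Im w\<bar> + (\<delta> - ln \<delta>) * (Re w + 1)"
proof -
  define x y u where "x = Re w" and "y = Im w" and "u = Re w + 1"
  define t where "t = \<bar>y\<bar> / u"
  have u: "u \<ge> 1" "x = u - 1" "x \<ge> 0" using assms by (auto simp: u_def x_def)
  have nz: "w + 1 \<noteq> 0" using assms by (auto simp: complex_eq_iff)
  have im: "Im (Ln (w + 1)) = arctan (y / u)"
    using arg_conv_arctan[of "w + 1"] assms nz by (simp add: Arg_eq_Im_Ln y_def u_def)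
  have "(norm (w + 1))\<^sup>2 = u\<^sup>2 * (1 + t\<^sup>2)"
  proof -
    have "(norm (w + 1))\<^sup>2 = u\<^sup>2 + y\<^sup>2"
      by (simp only: cmod_power2) (simp add: u_def y_def)
    moreover have "t\<^sup>2 = y\<^sup>2 / u\<^sup>2" by (simp add: t_def power_divide)
    ultimately show ?thesis using u by (simp add: distrib_left)
  qed
  then have "2 * ln (norm (w + 1)) = ln (u\<^sup>2 * (1 + t\<^sup>2))"
    using nz by (metis ln_realpow of_nat_numeral zero_less_norm_iff)
  also have "\<dots> = 2 * ln u + ln (1 + t\<^sup>2)"
  proof -
    have "1 + t\<^sup>2 > 0" by (simp add: add_pos_nonneg)
    then show ?thesis using u by (simp add: ln_mult ln_realpow)
  qed
  also have "\<dots> \<le> 2 * ln u + 2 * (\<delta> * t + (\<delta> - 1 - ln \<delta>))"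
    using ln_one_plus_square_le[of t] ln_one_plus_le[of t \<delta>] assms u by (simp add: t_def)
  finally have lnle: "ln (norm (w + 1)) \<le> ln u + (\<delta> * t + (\<delta> - 1 - ln \<delta>))" by simp
  have t0: "t \<ge> 0" using u by (simp add: t_def)
  have "0 \<le> \<delta> * t + (\<delta> - 1 - ln \<delta>)"
    using ln_one_plus_le[OF t0 assms(2)] t0 by (smt (verit) ln_ge_zero)
  then have "x * (\<delta> * t + (\<delta> - 1 - ln \<delta>)) \<le> u * (\<delta> * t + (\<delta> - 1 - ln \<delta>))"
    using u by (intro mult_right_mono) auto
  also have "\<dots> = \<delta> * \<bar>y\<bar> + (\<delta> - 1 - ln \<delta>) * u" using u by (simp add: t_def algebra_simps)
  finally have 1: "x * (\<delta> * t + (\<delta> - 1 - ln \<delta>)) \<le> \<delta> * \<bar>y\<bar> + (\<delta> - 1 - ln \<delta>) * u" .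
  have "Re (w * Ln (w + 1)) = x * ln (norm (w + 1)) - y * arctan (y / u)"
    using nz im by (simp add: x_def y_def)
  also have "\<dots> \<le> x * (ln u + (\<delta> * t + (\<delta> - 1 - ln \<delta>))) - (pi / 2 * \<bar>y\<bar> - u)"
    using u lnle mult_arctan_quotient_ge[of u y] by (intro diff_mono mult_left_mono) auto
  also have "\<dots> \<le> x * ln u - (pi / 2 - \<delta>) * \<bar>y\<bar> + (\<delta> - ln \<delta>) * u"
    using 1 by (simp add: algebra_simps)
  finally show ?thesis by (simp add: x_def y_def u_def)
qed

lemma nn_integral_exp_abs_finite:
  fixes c :: real
  assumes "0 < c"
  shows "(\<integral>\<^sup>+y. ennreal (exp (- c * \<bar>y\<bar>)) \<partial>lborel) < \<infinity>"
proof -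
  have half: "(\<integral>\<^sup>+y. ennreal (exp (- c * y)) * indicator {0..} y \<partial>lborel) = ennreal (0 - (- exp (- c * 0) / c))"
  proof (rule nn_integral_FTC_atLeast)
    show "((\<lambda>y. - exp (- c * y) / c) has_real_derivative exp (- c * y)) (at y)" for y
      using assms by (auto intro!: derivative_eq_intros)
    have "filterlim (\<lambda>y. c * y) at_top at_top"
      using filterlim_tendsto_pos_mult_at_top[OF tendsto_const assms filterlim_ident] .
    then have "((\<lambda>y. exp (- (c * y))) \<longlongrightarrow> 0) at_top"
      by (intro filterlim_compose[OF exp_at_bot]) (simp add: filterlim_uminus_at_top)
    then have "((\<lambda>y. - exp (- (c * y)) / c) \<longlongrightarrow> - 0 / c) at_top"
      using assms by (intro tendsto_intros) auto
    then show "((\<lambda>y. - exp (- c * y) / c) \<longlongrightarrow> 0) at_top" by simp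
  qed auto
  let ?g = "\<lambda>y. ennreal (exp (- c * y)) * indicator {0..} y"
  have "(\<integral>\<^sup>+y. ennreal (exp (- c * \<bar>y\<bar>)) \<partial>lborel) \<le> (\<integral>\<^sup>+y. ?g y + ?g (- y) \<partial>lborel)"
    by (intro nn_integral_mono) (auto simp: indicator_def abs_if)
  also have "\<dots> = (\<integral>\<^sup>+y. ?g y \<partial>lborel) + (\<integral>\<^sup>+y. ?g (- y) \<partial>lborel)"
    by (intro nn_integral_add) measurable
  also have "(\<integral>\<^sup>+y. ?g (- y) \<partial>lborel) = (\<integral>\<^sup>+y. ?g y \<partial>lborel)"
    using nn_integral_real_affine[of ?g "-1" 0] by simp
  finally have "(\<integral>\<^sup>+y. ennreal (exp (- c * \<bar>y\<bar>)) \<partial>lborel) \<le> (\<integral>\<^sup>+y. ?g y \<partial>lborel) + (\<integral>\<^sup>+y. ?g y \<partial>lborel)" .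
  also have "\<dots> < \<infinity>" unfolding half by simp
  finally show ?thesis .
qed

lemma power_div_fact_le_exp:
  fixes x :: real
  assumes "0 \<le> x"
  shows "x ^ n / fact n \<le> exp x"
proof -
  have sums: "(\<lambda>k. x ^ k / fact k) sums exp x"
    using exp_converges[of x] by (simp add: divide_inverse mult.commute)
  have "(\<Sum>k\<in>{n}. x ^ k / fact k) \<le> (\<Sum>k. x ^ k / fact k)"
    by (rule sum_le_suminf) (use sums assms in \<open>auto simp: sums_iff\<close>)
  then show ?thesis using sums by (simp add: sums_iff)
qed

text \<open>
  The factor \<open>exp (-2 x)\<close> in the bound becomes \<open>exp (-2 n)\<close> in the square on the line \<open>x = n/2\<close> and outweighs
  the growth \<open>exp (n + 2)\<close> left over by the weights \<open>2\<^sup>n/n!\<close>.  The boundary values are attained in the mean by dominated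
  convergence.
\<close>
lemma M2_omega_if_bounded:
  assumes an: "f analytic_on {w. 0 \<le> Re w}" and "0 < \<delta>" "0 \<le> C"
    and bound: "\<And>w. 0 \<le> Re w \<Longrightarrow> norm (f w) \<le> C * exp (Re w * ln (Re w + 1) - 2 * Re w - \<delta> * \<bar>Im w\<bar>)"
  shows "f \<in> M2_omega"
proof -
  have cont: "continuous_on {w. 0 \<le> Re w} f"
    by (intro holomorphic_on_imp_continuous_on analytic_imp_holomorphic an)
  have hol: "f holomorphic_on {w. 0 < Re w}"
    by (rule holomorphic_on_subset[OF analytic_imp_holomorphic[OF an]]) auto
  define e where "e = (\<lambda>y. exp (- (2 * \<delta>) * \<bar>y\<bar>))"
  define I where "I = (\<integral>\<^sup>+y. ennreal (e y) \<partial>lborel)"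
  have I: "I < \<infinity>" unfolding I_def e_def using \<open>0 < \<delta>\<close> by (intro nn_integral_exp_abs_finite) auto
  have [measurable]: "e \<in> borel_measurable borel" unfolding e_def by measurable
  define B where "B = (\<lambda>x. C\<^sup>2 * exp (2 * (x * ln (x + 1)) - 4 * x))"
  have B0: "0 \<le> B x" for x by (simp add: B_def)
  have sq: "(norm (f (Complex x y)))\<^sup>2 \<le> B x * e y" if "0 \<le> x" for x y
  proof -
    have "(norm (f (Complex x y)))\<^sup>2 \<le> (C * exp (x * ln (x + 1) - 2 * x - \<delta> * \<bar>y\<bar>))\<^sup>2"
      using bound[of "Complex x y"] that by (intro power_mono) auto
    also have "\<dots> = B x * e y"
      by (simp add: B_def e_def power_mult_distrib exp_double[symmetric] exp_add[symmetric] algebra_simps)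
    finally show ?thesis .
  qed
  have slice: "(\<integral>\<^sup>+y. ennreal ((norm (f (Complex x y)))\<^sup>2) \<partial>lborel) \<le> ennreal (B x) * I" if "0 \<le> x" for x
  proof -
    have "(\<integral>\<^sup>+y. ennreal ((norm (f (Complex x y)))\<^sup>2) \<partial>lborel) \<le> (\<integral>\<^sup>+y. ennreal (B x) * ennreal (e y) \<partial>lborel)"
      using sq[OF that] B0[of x] by (intro nn_integral_mono) (simp add: ennreal_mult'[symmetric] ennreal_leI)
    then show ?thesis by (simp add: nn_integral_cmult I_def)
  qed
  have B_le: "B x \<le> C\<^sup>2 * exp (2 * (b * ln (b + 1)))" if "0 \<le> x" "x \<le> b" for x b
  proof -
    have "x * ln (x + 1) \<le> b * ln (b + 1)" using that by (intro mult_mono) auto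
    then show ?thesis using that unfolding B_def by (intro mult_left_mono) auto
  qed
  have meas: "(\<lambda>y. f (Complex x y)) \<in> borel_measurable borel" if "0 \<le> x" for x
    using cont that by (rule borel_measurable_vertical_slice)
  have H2: "f \<in> H2_strip b" if "b > 0" for b
  proof -
    have "(SUP x\<in>{0<..<b}. \<integral>\<^sup>+ y. ennreal ((norm (f (Complex x y)))\<^sup>2) \<partial>lborel)
            \<le> ennreal (C\<^sup>2 * exp (2 * (b * ln (b + 1)))) * I"
    proof (rule SUP_least)
      fix x assume "x \<in> {0<..<b}"
      then have "0 \<le> x" "x \<le> b" by auto
      from slice[OF this(1)] B_le[OF this]
      show "(\<integral>\<^sup>+ y. ennreal ((norm (f (Complex x y)))\<^sup>2) \<partial>lborel) \<le> ennreal (C\<^sup>2 * exp (2 * (b * ln (b + 1)))) * I"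
        by (meson ennreal_leI mult_right_mono order_trans zero_le)
    qed
    also have "\<dots> < \<infinity>" using I by (simp add: ennreal_mult_less_top)
    finally show ?thesis
      by (auto simp: H2_strip_def strip_def intro: holomorphic_on_subset[OF hol])
  qed
  let ?g = "\<lambda>y. f (Complex 0 y)"
  have L2: "L2_boundary_value f ?g"
    unfolding L2_boundary_value_def
  proof (intro conjI)
    show "?g \<in> borel_measurable borel" by (rule meas) simp
    have "(\<integral>\<^sup>+ y. ennreal ((norm (f (Complex 0 y)))\<^sup>2) \<partial>lborel) \<le> ennreal (B 0) * I" by (rule slice) simp
    also have "\<dots> < \<infinity>" using I by (simp add: ennreal_mult_less_top)
    finally show "(\<integral>\<^sup>+ y. ennreal ((norm (f (Complex 0 y)))\<^sup>2) \<partial>lborel) < \<infinity>" .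
    show "((\<lambda>x. \<integral>\<^sup>+ y. ennreal ((norm (f (Complex x y) - f (Complex 0 y)))\<^sup>2) \<partial>lborel) \<longlongrightarrow> 0) (at_right 0)"
    proof (rule tendsto_at_right_sequentially[of 0 1])
      fix S :: "nat \<Rightarrow> real" assume S: "\<And>n. 0 < S n" "\<And>n. S n < 1" "S \<longlonglongrightarrow> 0"
      define A where "A = C\<^sup>2 * exp (2 * (1 * ln (1 + 1)))"
      have A0: "A \<ge> 0" by (simp add: A_def)
      have "(\<lambda>n. \<integral>\<^sup>+ y. ennreal ((norm (f (Complex (S n) y) - f (Complex 0 y)))\<^sup>2) \<partial>lborel)
              \<longlonglongrightarrow> (\<integral>\<^sup>+ y. 0 \<partial>(lborel :: real measure))"
      proof (rule nn_integral_dominated_convergence[where w = "\<lambda>y. ennreal (4 * A) * ennreal (e y)"])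
        show "(\<lambda>y. ennreal ((norm (f (Complex (S n) y) - f (Complex 0 y)))\<^sup>2)) \<in> borel_measurable lborel" for n
        proof -
          have [measurable]: "(\<lambda>y. f (Complex (S n) y)) \<in> borel_measurable borel" "(\<lambda>y. f (Complex 0 y)) \<in> borel_measurable borel"
            using S(1)[of n] by (auto intro!: meas)
          show ?thesis by measurable
        qed
        show "AE y in lborel. ennreal ((norm (f (Complex (S n) y) - f (Complex 0 y)))\<^sup>2) \<le> ennreal (4 * A) * ennreal (e y)" for n
        proof (intro AE_I2)
          fix y
          have one: "(norm (f (Complex x y)))\<^sup>2 \<le> A * e y" if "0 \<le> x" "x \<le> 1" for x
          proof -
            have "B x * e y \<le> A * e y"
              unfolding A_def using that by (intro mult_right_mono B_le) (auto simp: e_def)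
            with sq[OF that(1), of y] show ?thesis by linarith
          qed
          have "(norm (f (Complex (S n) y) - f (Complex 0 y)))\<^sup>2 \<le> (norm (f (Complex (S n) y)) + norm (f (Complex 0 y)))\<^sup>2"
            by (intro power_mono norm_triangle_ineq4) auto
          also have "\<dots> \<le> 2 * (norm (f (Complex (S n) y)))\<^sup>2 + 2 * (norm (f (Complex 0 y)))\<^sup>2"
            using sum_squares_bound[of "norm (f (Complex (S n) y))" "norm (f (Complex 0 y))"]
            by (simp add: power2_sum)
          also have "\<dots> \<le> 4 * A * e y" using one[of "S n"] one[of 0] S(1,2)[of n] by simp
          finally show "ennreal ((norm (f (Complex (S n) y) - f (Complex 0 y)))\<^sup>2) \<le> ennreal (4 * A) * ennreal (e y)"
            using A0 by (simp add: ennreal_mult'[symmetric] ennreal_leI)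
        qed
        show "(\<integral>\<^sup>+ y. ennreal (4 * A) * ennreal (e y) \<partial>lborel) < \<infinity>"
          using I by (simp add: nn_integral_cmult I_def[symmetric] ennreal_mult_less_top)
        show "AE y in lborel. (\<lambda>n. ennreal ((norm (f (Complex (S n) y) - f (Complex 0 y)))\<^sup>2)) \<longlonglongrightarrow> 0"
        proof (intro AE_I2)
          fix y
          have "(\<lambda>n. Complex (S n) y) \<longlonglongrightarrow> Complex 0 y" by (intro tendsto_Complex S(3) tendsto_const)
          then have "(\<lambda>n. f (Complex (S n) y)) \<longlonglongrightarrow> f (Complex 0 y)"
            using S(1) by (intro continuous_on_tendsto_compose[OF cont]) (auto simp: less_imp_le)
          then have "(\<lambda>n. ennreal ((norm (f (Complex (S n) y) - f (Complex 0 y)))\<^sup>2)) \<longlonglongrightarrow> ennreal ((norm (f (Complex 0 y) - f (Complex 0 y)))\<^sup>2)"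
            by (intro tendsto_intros)
          then show "(\<lambda>n. ennreal ((norm (f (Complex (S n) y) - f (Complex 0 y)))\<^sup>2)) \<longlonglongrightarrow> 0" by simp
        qed
      qed auto
      then show "(\<lambda>n. \<integral>\<^sup>+ y. ennreal ((norm (f (Complex (S n) y) - f (Complex 0 y)))\<^sup>2) \<partial>lborel) \<longlonglongrightarrow> 0" by simp
    qed simp
  qed
  have "(\<integral>\<^sup>+ w. ennreal ((norm (extend_to_boundary f ?g w))\<^sup>2) \<partial>omega) < \<infinity>"
  proof -
    have ext: "extend_to_boundary f ?g = (\<lambda>w. indicator {w. 0 \<le> Re w} w *\<^sub>R f w)"
    proof
      fix w :: complex
      have "Complex 0 (Im w) = w" if "Re w = 0" using that by (simp add: complex_eq_iff)
      then show "extend_to_boundary f ?g w = indicator {w. 0 \<le> Re w} w *\<^sub>R f w"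
        by (auto simp: extend_to_boundary_def)
    qed
    have [measurable]: "extend_to_boundary f ?g \<in> borel_measurable borel"
      unfolding ext by (intro borel_measurable_continuous_on_indicator cont borel_closed closed_halfspace_Re_ge)
    have "(\<integral>\<^sup>+ w. ennreal ((norm (extend_to_boundary f ?g w))\<^sup>2) \<partial>omega)
       = (\<Sum>n. ennreal (2 ^ n / fact n) * (\<integral>\<^sup>+ y. ennreal ((norm (extend_to_boundary f ?g (Complex (real n / 2) y)))\<^sup>2) \<partial>lborel))"
      by (rule nn_integral_omega) measurable
    also have "\<dots> \<le> (\<Sum>n. ennreal (C\<^sup>2 * exp 2 * (exp (-1)) ^ n) * I)"
    proof (intro suminf_le summableI)
      fix n :: nat
      let ?x = "real n / 2"
      have "ennreal (2 ^ n / fact n) * (\<integral>\<^sup>+ y. ennreal ((norm (extend_to_boundary f ?g (Complex ?x y)))\<^sup>2) \<partial>lborel)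
         \<le> ennreal (2 ^ n / fact n) * (ennreal (B ?x) * I)"
        using slice[of ?x] by (intro mult_left_mono) (auto simp: ext)
      also have "\<dots> = ennreal (2 ^ n / fact n * B ?x) * I"
      proof -
        have "ennreal (2 ^ n / fact n * B ?x) = ennreal (2 ^ n / fact n) * ennreal (B ?x)"
          using B0[of ?x] by (intro ennreal_mult) auto
        then show ?thesis by (simp only: mult.assoc)
      qed
      also have "\<dots> \<le> ennreal (C\<^sup>2 * exp 2 * (exp (-1)) ^ n) * I"
      proof (intro mult_right_mono ennreal_leI)
        have "(real n + 2) ^ n / fact n \<le> exp (real n + 2)"
          by (rule power_div_fact_le_exp) auto
        moreover have "2 ^ n * exp (2 * (?x * ln (?x + 1))) = (real n + 2) ^ n"
        proof -
          have "exp (2 * (?x * ln (?x + 1))) = exp (real n * ln (?x + 1))" by simp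
          also have "\<dots> = exp (ln (?x + 1)) ^ n" by (rule exp_of_nat_mult)
          also have "exp (ln (?x + 1)) = ?x + 1" by (rule exp_ln) (simp add: add_nonneg_pos)
          finally show ?thesis by (simp add: power_mult_distrib[symmetric] algebra_simps)
        qed
        ultimately have key: "2 ^ n * exp (2 * (?x * ln (?x + 1))) / fact n \<le> exp (real n + 2)" by simp
        have "2 ^ n / fact n * B ?x = C\<^sup>2 * (2 ^ n * exp (2 * (?x * ln (?x + 1))) / fact n) * exp (- 2 * real n)"
          by (simp add: B_def exp_diff exp_minus field_simps)
        also have "\<dots> \<le> C\<^sup>2 * exp (real n + 2) * exp (- 2 * real n)"
          using key by (intro mult_right_mono mult_left_mono) auto
        also have "\<dots> = C\<^sup>2 * exp 2 * exp (- 1) ^ n"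
          by (simp add: exp_of_nat_mult[symmetric] mult.assoc exp_add[symmetric])
        finally show "2 ^ n / fact n * B ?x \<le> C\<^sup>2 * exp 2 * exp (- 1) ^ n" .
      qed auto
      finally show "ennreal (2 ^ n / fact n) * (\<integral>\<^sup>+ y. ennreal ((norm (extend_to_boundary f ?g (Complex ?x y)))\<^sup>2) \<partial>lborel)
         \<le> ennreal (C\<^sup>2 * exp 2 * (exp (-1)) ^ n) * I" .
    qed
    also have "\<dots> = (\<Sum>n. ennreal (C\<^sup>2 * exp 2 * (exp (-1)) ^ n)) * I" by (rule ennreal_suminf_multc)
    also have "(\<Sum>n. ennreal (C\<^sup>2 * exp 2 * (exp (-1)) ^ n)) = ennreal (\<Sum>n. C\<^sup>2 * exp 2 * (exp (-1)) ^ n)"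
      by (intro suminf_ennreal2 summable_mult summable_geometric) auto
    also have "\<dots> * I < \<infinity>" using I by (simp add: ennreal_mult_less_top)
    finally show ?thesis .
  qed
  with L2 H2 hol show ?thesis
    by (auto simp: M2_omega_def right_half_plane_def)
qed

text \<open>
  The gap between \<open>\<pi> d\<close> and \<open>\<pi>/2\<close> is divided into three equal parts \<open>\<delta>\<close>: one absorbs the
  logarithmic term in the growth of the canonical product, one the loss in the decay of
  \<open>exp (w Ln (w + 1))\<close>, and one remains as exponential decay along vertical lines.
\<close>
lemma zero_set_sufficient_condition:
  fixes z :: "nat \<Rightarrow> complex"
  assumes zR: "\<And>j. 0 < Re (z j)" and z1: "\<And>j. 1 \<le> norm (z j)"
    and lim: "filterlim (\<lambda>j. norm (z j)) at_top sequentially"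
    and summ: "summable (\<lambda>j. 1 / (norm (z j))\<^sup>2)"
    and count: "\<And>s. 1 \<le> s \<Longrightarrow> real (counting z s) \<le> N + d * s" "0 \<le> N" "0 \<le> d" "d < 1 / 2"
  shows "is_zero_set (M2_omega \<inter> Hol_closed_half_plane) z"
proof -
  obtain P where P: "P holomorphic_on UNIV" "\<And>w. 0 \<le> Re w \<Longrightarrow> P w = 0 \<longleftrightarrow> w \<in> range z"
    "\<And>w. w \<in> range z \<Longrightarrow> zorder P w = int (card {j. z j = w})"
    "\<And>w. w \<noteq> 0 \<Longrightarrow> norm (P w) \<le> exp (N * ln (1 + (norm w)\<^sup>2) + d * (pi * norm w))"
    using even_canonical_product_exists[OF zR z1 lim summ count(1-3)] by blast
  define \<delta> where "\<delta> = (pi / 2 - pi * d) / 3"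
  have \<delta>: "\<delta> > 0" using count(4) pi_gt_zero by (simp add: \<delta>_def field_simps)
  \<comment> \<open>With slope \<open>\<eta>\<close>, the term \<open>N ln (1 + r\<^sup>2)\<close> is at most \<open>\<delta> r\<close> plus a constant.\<close>
  define \<eta> where "\<eta> = \<delta> / (2 * N + 1)"
  have \<eta>: "\<eta> > 0" "2 * N * \<eta> \<le> \<delta>"
    using \<delta> count(2) by (auto simp: \<eta>_def field_simps)
  define \<tau> where "\<tau> = pi * d + \<delta>"
  define c0 where "c0 = 2 * N * (\<eta> - 1 - ln \<eta>)"
  have P_le: "norm (P w) \<le> exp (c0 + \<tau> * norm w)" if "w \<noteq> 0" for w
  proof -
    have "ln (1 + (norm w)\<^sup>2) \<le> 2 * (\<eta> * norm w + (\<eta> - 1 - ln \<eta>))"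
      using ln_one_plus_square_le[of "norm w"] ln_one_plus_le[of "norm w" \<eta>] \<eta>(1) by simp
    then have "N * ln (1 + (norm w)\<^sup>2) \<le> N * (2 * (\<eta> * norm w + (\<eta> - 1 - ln \<eta>)))"
      using count(2) by (intro mult_left_mono)
    also have "\<dots> = 2 * N * \<eta> * norm w + c0" by (simp add: c0_def algebra_simps)
    also have "\<dots> \<le> \<delta> * norm w + c0" using \<eta>(2) by (intro add_right_mono mult_right_mono) auto
    finally show ?thesis
      using P(4)[OF that] by (elim order_trans) (simp add: \<tau>_def algebra_simps)
  qed
  define b where "b = \<delta> - ln \<delta>"
  \<comment> \<open>\<open>\<tau>\<close> and \<open>b\<close> are the rates of growth in \<open>Re w\<close> of the other two factors beyond \<open>(Re w + 1) powr Re w\<close>.\<close>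
  \<comment> \<open>The summand 2 provides the decay \<open>exp (-2 Re w)\<close> that membership in the space requires.\<close>
  define a where "a = \<tau> + b + 2"
  define f where "f = (\<lambda>w. P w * exp (w * Ln (w + 1) - of_real a * w))"
  have nonpos: "w + 1 \<notin> \<real>\<^sub>\<le>\<^sub>0" if "0 \<le> Re w" for w :: complex
    using that by (auto simp: complex_nonpos_Reals_iff)
  have Pan: "P analytic_on S" for S using P(1) analytic_on_holomorphic by blast
  have an: "f analytic_on {w. 0 \<le> Re w}"
    unfolding f_def by (intro analytic_intros Pan) (use nonpos in auto)
  have zeros: "f w = 0 \<longleftrightarrow> w \<in> range z" if "0 \<le> Re w" for w
    using P(2)[OF that] by (simp add: f_def)
  have bound_nz: "norm (f w) \<le> exp (c0 + b) * exp (Re w * ln (Re w + 1) - 2 * Re w - \<delta> * \<bar>Im w\<bar>)"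
    if "0 \<le> Re w" "w \<noteq> 0" for w
  proof -
    have "norm (f w) = norm (P w) * exp (Re (w * Ln (w + 1)) - a * Re w)"
      by (simp add: f_def norm_mult norm_exp_eq_Re)
    also have "\<dots> \<le> exp (c0 + \<tau> * norm w) * exp (Re (w * Ln (w + 1)) - a * Re w)"
      by (intro mult_right_mono P_le that) auto
    also have "\<dots> = exp (c0 + \<tau> * norm w + (Re (w * Ln (w + 1)) - a * Re w))"
      by (rule exp_add[symmetric])
    also have "\<dots> \<le> exp (c0 + b + (Re w * ln (Re w + 1) - 2 * Re w - \<delta> * \<bar>Im w\<bar>))"
    proof (subst exp_le_cancel_iff)
      have "\<tau> \<ge> 0" using \<delta> count(3) by (simp add: \<tau>_def)
      then have "\<tau> * norm w \<le> \<tau> * (Re w + \<bar>Im w\<bar>)"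
        using cmod_le[of w] that by (intro mult_left_mono) auto
      moreover have "Re (w * Ln (w + 1)) \<le> Re w * ln (Re w + 1) - (pi / 2 - \<delta>) * \<bar>Im w\<bar> + b * (Re w + 1)"
        unfolding b_def using Re_mult_Ln_plus_one_le[OF that(1) \<delta>] .
      moreover have "\<tau> * \<bar>Im w\<bar> - (pi / 2 - \<delta>) * \<bar>Im w\<bar> = - \<delta> * \<bar>Im w\<bar>"
      proof -
        have "\<tau> - (pi / 2 - \<delta>) = - \<delta>" by (simp add: \<tau>_def \<delta>_def field_simps)
        then show ?thesis by (metis left_diff_distrib)
      qed
      ultimately show "c0 + \<tau> * norm w + (Re (w * Ln (w + 1)) - a * Re w)
          \<le> c0 + b + (Re w * ln (Re w + 1) - 2 * Re w - \<delta> * \<bar>Im w\<bar>)"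
        by (simp add: a_def algebra_simps)
    qed
    also have "\<dots> = exp (c0 + b) * exp (Re w * ln (Re w + 1) - 2 * Re w - \<delta> * \<bar>Im w\<bar>)" by (rule exp_add)
    finally show ?thesis .
  qed
  \<comment> \<open>The growth estimate of the canonical product excludes the origin, where the exponential factor is 1.\<close>
  have "norm (f w) \<le> max (exp (c0 + b)) (norm (f 0)) * exp (Re w * ln (Re w + 1) - 2 * Re w - \<delta> * \<bar>Im w\<bar>)"
    if "0 \<le> Re w" for w
  proof (cases "w = 0")
    case False
    show ?thesis
      by (rule order_trans[OF bound_nz[OF that False]]) (intro mult_right_mono, auto)
  qed simp
  then have "f \<in> M2_omega"
    by (intro M2_omega_if_bounded[OF an \<delta>, of "max (exp (c0 + b)) (norm (f 0))"]) (auto simp: max_def)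
  moreover have "f \<in> Hol_closed_half_plane"
    using an by (simp add: Hol_closed_half_plane_def closure_right_half_plane)
  moreover have "\<exists>w\<in>closure right_half_plane. f w \<noteq> 0"
  proof -
    have "norm (0 :: complex) < 1" by simp
    then have "0 \<notin> range z" using z1 by (metis imageE not_le)
    then show ?thesis using zeros[of 0] by (intro bexI[of _ 0]) (auto simp: closure_right_half_plane)
  qed
  moreover have "{w \<in> closure right_half_plane. f w = 0} = range z"
    using zeros zR by (auto simp: closure_right_half_plane less_imp_le)
  moreover have "finite {j. z j = w} \<and> zorder f w = int (card {j. z j = w})" if w: "w \<in> range z" for w
  proof
    show "finite {j. z j = w}"
      by (rule finite_subset[OF _ finite_norm_le[OF lim, of "norm w"]]) auto
    have Rew: "0 < Re w" using w zR by auto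
    have ev: "eventually (\<lambda>v. P v \<noteq> 0) (at w)"
    proof (rule eventually_mono[OF non_zero_neighbour_alt[of P UNIV w 0]])
      show "P 0 \<noteq> 0" using P(2)[of 0] z1 by (metis imageE norm_zero not_one_le_zero order_refl zero_complex.simps(1))
    qed (use P(1) in auto)
    have "zorder f w = zorder P w + zorder (\<lambda>w. exp (w * Ln (w + 1) - of_real a * w)) w"
      unfolding f_def
    proof (rule zorder_times_analytic[OF Pan])
      show "eventually (\<lambda>v. P v * exp (v * Ln (v + 1) - of_real a * v) \<noteq> 0) (at w)" using ev by simp
    qed (use nonpos Rew in \<open>auto intro!: analytic_intros\<close>)
    also have "zorder (\<lambda>w. exp (w * Ln (w + 1) - of_real a * w)) w = 0"
      by (rule zorder_eq_0I) (use nonpos Rew in \<open>auto intro!: analytic_intros\<close>)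
    finally show "zorder f w = int (card {j. z j = w})" using P(3)[OF w] by simp
  qed
  ultimately show ?thesis unfolding is_zero_set_def by blast
qed

lemma summable_square_of_exponent_of_convergence_less:
  fixes z :: "nat \<Rightarrow> complex"
  assumes "exponent_of_convergence z < 2" and z1: "\<And>j. 1 \<le> norm (z j)"
  shows "summable (\<lambda>j. 1 / (norm (z j))\<^sup>2)"
proof -
  from assms(1) obtain \<rho> where \<rho>: "ereal \<rho> < 2" "summable (\<lambda>j. 1 / norm (z j) powr \<rho>)"
    unfolding exponent_of_convergence_def Inf_less_iff by auto
  show ?thesis
  proof (rule summable_comparison_test'[OF \<rho>(2)])
    fix j :: nat
    have pos: "0 < norm (z j)" using z1[of j] by linarith
    have "\<rho> \<le> 2" using \<rho>(1) by simp
    then have "norm (z j) powr \<rho> \<le> norm (z j) powr 2" using z1[of j] by (intro powr_mono) auto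
    then have "1 / norm (z j) powr 2 \<le> 1 / norm (z j) powr \<rho>" using pos by (intro divide_left_mono) auto
    then show "norm (1 / (norm (z j))\<^sup>2) \<le> 1 / norm (z j) powr \<rho>"
      using pos by (simp add: powr_numeral)
  qed
qed

text \<open>
  The density only controls large radii; the constant \<open>N\<close> covers the bounded range below.
\<close>
lemma counting_bound_of_upper_density:
  fixes z :: "nat \<Rightarrow> complex"
  assumes lim: "filterlim (\<lambda>j. norm (z j)) at_top sequentially"
    and expo: "exponent_of_convergence z = 1" and dens: "upper_density z < ereal D"
  obtains N d where "0 \<le> N" "0 \<le> d" "d < D" "\<And>s. 1 \<le> s \<Longrightarrow> real (counting z s) \<le> N + d * s"
proof -
  have mono: "counting z r \<le> counting z s" if "r \<le> s" for r s
    unfolding counting_def using that by (intro card_mono finite_norm_le lim) auto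
  obtain d where d: "upper_density z < ereal d" "d < D"
    using ereal_dense2[OF dens] by auto
  have "eventually (\<lambda>r. ereal (real (counting z r) / r powr 1) < ereal d) at_top"
    using Limsup_lessD[OF d(1)[unfolded upper_density_def]] by (simp add: expo)
  then obtain r0 where r0: "\<And>r. r \<ge> r0 \<Longrightarrow> real (counting z r) / r powr 1 < d"
    by (auto simp: eventually_at_top_linorder)
  define r1 where "r1 = max r0 1"
  have le: "real (counting z r) \<le> d * r" if "r \<ge> r1" for r
    using r0[of r] that by (simp add: r1_def field_simps)
  have d0: "0 \<le> d" using r0[of r1] by (smt (verit) divide_nonneg_nonneg of_nat_0_le_iff powr_ge_zero r1_def)
  show ?thesis
  proof (rule that[of "real (counting z r1)" d])
    fix s :: real assume "1 \<le> s"
    show "real (counting z s) \<le> real (counting z r1) + d * s"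
    proof (cases "s \<ge> r1")
      case True
      then show ?thesis using le[of s] by simp
    next
      case False
      then have "real (counting z s) \<le> real (counting z r1)" using mono[of s r1] by simp
      moreover have "0 \<le> d * s" using d0 \<open>1 \<le> s\<close> by simp
      ultimately show ?thesis by linarith
    qed
  qed (use d0 d in auto)
qed

section \<open>Zero-sets\<close>

theorem theorem6:
  fixes z :: "nat \<Rightarrow> complex"
  assumes "\<forall>j. z j \<in> right_half_plane"
    and "\<forall>j. 1 \<le> norm (z j)"
    and "filterlim (\<lambda>j. norm (z j)) at_top sequentially"
  shows "(exponent_of_convergence z = 1 \<and> upper_density z < ereal (1 / 2) \<longrightarrow>
            is_zero_set (M2_omega \<inter> Hol_closed_half_plane) z) \<and>
         (is_zero_set (M2_omega \<inter> Hol_closed_half_plane) z \<longrightarrow>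
            Limsup at_top (\<lambda>R. ereal (1 / ln R * (\<Sum>j\<in>{j. norm (z j) \<le> R}. Re (1 / z j))))
              \<le> ereal (2 / pi))"
proof (intro conjI impI)
  assume "exponent_of_convergence z = 1 \<and> upper_density z < ereal (1 / 2)"
  then have expo: "exponent_of_convergence z = 1" and dens: "upper_density z < ereal (1 / 2)" by auto
  obtain N d where "0 \<le> N" "0 \<le> d" "d < 1 / 2" "\<And>s. 1 \<le> s \<Longrightarrow> real (counting z s) \<le> N + d * s"
    using counting_bound_of_upper_density[OF assms(3) expo dens] by blast
  moreover have "summable (\<lambda>j. 1 / (norm (z j))\<^sup>2)"
    by (rule summable_square_of_exponent_of_convergence_less) (use expo assms(2) in auto)
  ultimately show "is_zero_set (M2_omega \<inter> Hol_closed_half_plane) z"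
    using assms by (intro zero_set_sufficient_condition) (auto simp: right_half_plane_def)
next
  assume "is_zero_set (M2_omega \<inter> Hol_closed_half_plane) z"
  with assms show "Limsup at_top (\<lambda>R. ereal (1 / ln R * (\<Sum>j\<in>{j. norm (z j) \<le> R}. Re (1 / z j))))
              \<le> ereal (2 / pi)"
    by (rule zero_set_necessary_condition)
qed

end
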